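(* For any $f\in V^*$ there exists a unique $u\in V_0$ such that $$A^\delta(u,v)=\langle f,v\rangle\qquad\text{for all } v\in V_0 .$$ Furthermore, there holds the estimate $\|u\|_V\le \|f\|_{V^*}$.
   Context: $\Omega\subset\mathbf{R}^2$ is a bounded domain with piecewise smooth boundary and outward unit normal $n=(n_1,n_2)$; $0<\delta\ll 1$ is a given (small) number. Write $\Box v:=\partial_{xx}v-\partial_{yy}v$ (in the sense of distributions), $\bar n:=(n_1,-n_2)$, $\partial_{\bar n}v:=\nabla v\cdot\bar n$. Set $$V:=\{v\in H^1(\Omega):\ \Box v\in L^2(\Omega)\},\qquad V_0:=\{v\in V\cap H^1_0(\Omega):\ \partial_{\bar n}v|_{\partial\Omega}=0\},$$ where, for $v\in V$, the boundary trace $\partial_{\bar n}v=(v_x,-v_y)\cdot n$ is the normal trace of the field $(v_x,-v_y)\in H(\mathrm{div};\Omega)$. Let $(\cdot,\cdot)$ be the $L^2(\Omega)$ inner product and $$(v,w)_V:=\delta(\Box v,\Box w)+(\nabla v,\nabla w),\qquad \|v\|_V:=\sqrt{(v,v)_V},\qquad A^\delta(v,w):=(v,w)_V .$$ $V_0$ is equipped with the norm $\|\cdot\|_V$; $V^*$ is the dual space, $\langle\cdot,\cdot\rangle$ the duality pairing, and $\|f\|_{V^*}:=\sup_{0\ne v\in V_0}|\langle f,v\rangle|/\|v\|_V$. The variational problem is the weak form of $\delta\Box^2u-\Delta u=f$ in $\Omega$, $u=\partial_{\bar n}u=0$ on $\partial\Omega$, where $\Box^2u=\Box(\Box u)$.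 *)

theory Defs
  imports "HOL-Analysis.Analysis"
begin

definition is_domain :: "(real^2) set \<Rightarrow> bool" where
  "is_domain \<Omega> \<longleftrightarrow> open \<Omega> \<and> connected \<Omega> \<and> \<Omega> \<noteq> {}"

text \<open>\<open>C\<^sup>\<infinity>\<close> up to the endpoints (one-sided derivatives of all orders) with non-vanishing velocity;
  \<open>D k\<close> is the \<open>k\<close>-th derivative.\<close>

definition smooth_regular_arc :: "real \<Rightarrow> real \<Rightarrow> (real \<Rightarrow> real^2) \<Rightarrow> bool" where
  "smooth_regular_arc a b \<gamma> \<longleftrightarrow>
     (\<exists>D :: nat \<Rightarrow> real \<Rightarrow> real^2.
        (\<forall>t\<in>{a..b}. D 0 t = \<gamma> t) \<and>
        (\<forall>k. \<forall>t\<in>{a..b}. (D k has_vector_derivative D (Suc k) t) (at t within {a..b})) \<and>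
        (\<forall>t\<in>{a..b}. D 1 t \<noteq> 0))"

definition piecewise_smooth_closed_curve :: "(real \<Rightarrow> real^2) \<Rightarrow> bool" where
  "piecewise_smooth_closed_curve \<gamma> \<longleftrightarrow>
     simple_path \<gamma> \<and> pathfinish \<gamma> = pathstart \<gamma> \<and>
     (\<exists>(m::nat) (t :: nat \<Rightarrow> real).
        t 0 = 0 \<and> t m = 1 \<and>
        (\<forall>j<m. t j < t (Suc j) \<and> smooth_regular_arc (t j) (t (Suc j)) \<gamma>))"

text \<open>A connected open set bounded by disjoint Jordan curves automatically lies on one side of each
  of them, so the outward normal is well defined away from the finitely many corners.\<close>

definition piecewise_smooth_boundary :: "(real^2) set \<Rightarrow> bool" where
  "piecewise_smooth_boundary \<Omega> \<longleftrightarrow>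
     (\<exists>\<Gamma>. finite \<Gamma> \<and> (\<forall>\<gamma>\<in>\<Gamma>. piecewise_smooth_closed_curve \<gamma>) \<and>
          pairwise (\<lambda>\<gamma> \<eta>. disjnt (path_image \<gamma>) (path_image \<eta>)) \<Gamma> \<and>
          frontier \<Omega> = (\<Union>\<gamma>\<in>\<Gamma>. path_image \<gamma>))"

definition partial :: "2 \<Rightarrow> (real^2 \<Rightarrow> real) \<Rightarrow> real^2 \<Rightarrow> real" where
  "partial i f x = frechet_derivative f (at x) (axis i 1)"

text \<open>\<open>foldr partial is f\<close> is the iterated partial derivative along the index list \<open>is\<close>.
  Differentiability of all of them makes all of them continuous, i.e. \<open>f\<close> is \<open>C\<^sup>\<infinity>\<close>.\<close>

definition smooth_fun :: "(real^2 \<Rightarrow> real) \<Rightarrow> bool" where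
  "smooth_fun f \<longleftrightarrow> (\<forall>is x. foldr partial is f differentiable (at x))"

text \<open>\<open>C\<^sub>c\<^sup>\<infinity>(\<Omega>)\<close>, its elements being extended by zero to the whole plane.\<close>

definition test_functions :: "(real^2) set \<Rightarrow> (real^2 \<Rightarrow> real) set" where
  "test_functions \<Omega> =
     {\<phi>. smooth_fun \<phi> \<and> compact (closure {x. \<phi> x \<noteq> 0}) \<and> closure {x. \<phi> x \<noteq> 0} \<subseteq> \<Omega>}"

text \<open>Elements of the function spaces below are represented by functions on the plane of which only
  the restriction to \<open>\<Omega>\<close>, up to null sets, matters.\<close>

definition L2 :: "(real^2) set \<Rightarrow> (real^2 \<Rightarrow> 'b::euclidean_space) set" where
  "L2 \<Omega> = {f \<in> borel_measurable (lebesgue_on \<Omega>).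
             integrable (lebesgue_on \<Omega>) (\<lambda>x. (norm (f x))\<^sup>2)}"

definition L2_inner ::
    "(real^2) set \<Rightarrow> (real^2 \<Rightarrow> 'b::euclidean_space) \<Rightarrow> (real^2 \<Rightarrow> 'b) \<Rightarrow> real" where
  "L2_inner \<Omega> f g = (LINT x|lebesgue_on \<Omega>. f x \<bullet> g x)"

definition has_weak_gradient ::
    "(real^2) set \<Rightarrow> (real^2 \<Rightarrow> real) \<Rightarrow> (real^2 \<Rightarrow> real^2) \<Rightarrow> bool" where
  "has_weak_gradient \<Omega> v G \<longleftrightarrow> G \<in> L2 \<Omega> \<and>
     (\<forall>\<phi>\<in>test_functions \<Omega>. \<forall>i.
        (LINT x|lebesgue_on \<Omega>. v x * partial i \<phi> x) = - (LINT x|lebesgue_on \<Omega>. G x $ i * \<phi> x))"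

definition has_weak_box :: "(real^2) set \<Rightarrow> (real^2 \<Rightarrow> real) \<Rightarrow> (real^2 \<Rightarrow> real) \<Rightarrow> bool" where
  "has_weak_box \<Omega> v g \<longleftrightarrow> g \<in> L2 \<Omega> \<and>
     (\<forall>\<phi>\<in>test_functions \<Omega>.
        (LINT x|lebesgue_on \<Omega>. v x * (partial 1 (partial 1 \<phi>) x - partial 2 (partial 2 \<phi>) x))
          = (LINT x|lebesgue_on \<Omega>. g x * \<phi> x))"

definition has_weak_div :: "(real^2) set \<Rightarrow> (real^2 \<Rightarrow> real^2) \<Rightarrow> (real^2 \<Rightarrow> real) \<Rightarrow> bool" where
  "has_weak_div \<Omega> F d \<longleftrightarrow> d \<in> L2 \<Omega> \<and>
     (\<forall>\<phi>\<in>test_functions \<Omega>.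
        (LINT x|lebesgue_on \<Omega>. F x $ 1 * partial 1 \<phi> x + F x $ 2 * partial 2 \<phi> x)
          = - (LINT x|lebesgue_on \<Omega>. d x * \<phi> x))"

text \<open>Weak derivatives are unique up to null sets, so the choices below are immaterial.\<close>

definition weak_grad :: "(real^2) set \<Rightarrow> (real^2 \<Rightarrow> real) \<Rightarrow> real^2 \<Rightarrow> real^2" where
  "weak_grad \<Omega> v = (SOME G. has_weak_gradient \<Omega> v G)"

definition weak_box :: "(real^2) set \<Rightarrow> (real^2 \<Rightarrow> real) \<Rightarrow> real^2 \<Rightarrow> real" where
  "weak_box \<Omega> v = (SOME g. has_weak_box \<Omega> v g)"

definition weak_div :: "(real^2) set \<Rightarrow> (real^2 \<Rightarrow> real^2) \<Rightarrow> real^2 \<Rightarrow> real" where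
  "weak_div \<Omega> F = (SOME d. has_weak_div \<Omega> F d)"

definition H1 :: "(real^2) set \<Rightarrow> (real^2 \<Rightarrow> real) set" where
  "H1 \<Omega> = {v \<in> L2 \<Omega>. \<exists>G. has_weak_gradient \<Omega> v G}"

definition H1_norm :: "(real^2) set \<Rightarrow> (real^2 \<Rightarrow> real) \<Rightarrow> real" where
  "H1_norm \<Omega> v = sqrt (L2_inner \<Omega> v v + L2_inner \<Omega> (weak_grad \<Omega> v) (weak_grad \<Omega> v))"

definition H10 :: "(real^2) set \<Rightarrow> (real^2 \<Rightarrow> real) set" where
  "H10 \<Omega> = {v \<in> H1 \<Omega>. \<exists>\<phi>. (\<forall>k::nat. \<phi> k \<in> test_functions \<Omega>) \<and>
              (\<lambda>k. H1_norm \<Omega> (\<lambda>x. v x - \<phi> k x)) \<longlonglongrightarrow> 0}"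

text \<open>The normal trace \<open>F \<cdot> n\<close> of a field \<open>F \<in> H(div;\<Omega>)\<close> is, as usual, the functional given by
  Green's formula \<open>\<langle>F \<cdot> n, w\<rangle> = (F, \<nabla>w) + (div F, w)\<close>. It vanishes for \<open>w \<in> H\<^sup>1\<^sub>0(\<Omega>)\<close> and hence
  is a functional of the boundary values of \<open>w \<in> H\<^sup>1(\<Omega>)\<close>, i.e. on \<open>H\<^sup>1(\<Omega>) / H\<^sup>1\<^sub>0(\<Omega>)\<close>, which is
  \<open>H\<^bsup>1/2\<^esup>(\<partial>\<Omega>)\<close>.\<close>

definition normal_trace ::
    "(real^2) set \<Rightarrow> (real^2 \<Rightarrow> real^2) \<Rightarrow> (real^2 \<Rightarrow> real) \<Rightarrow> real" where
  "normal_trace \<Omega> F w = L2_inner \<Omega> F (weak_grad \<Omega> w) + L2_inner \<Omega> (weak_div \<Omega> F) w"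

definition bar :: "real^2 \<Rightarrow> real^2" where
  "bar p = vector [p $ 1, - p $ 2]"

text \<open>Since \<open>\<nabla>v \<cdot> bar n = bar \<nabla>v \<cdot> n\<close>, the derivative along \<open>bar n\<close> is a normal trace.\<close>

definition conormal_trace :: "(real^2) set \<Rightarrow> (real^2 \<Rightarrow> real) \<Rightarrow> (real^2 \<Rightarrow> real) \<Rightarrow> real" where
  "conormal_trace \<Omega> v = normal_trace \<Omega> (\<lambda>x. bar (weak_grad \<Omega> v x))"

definition V_space :: "(real^2) set \<Rightarrow> (real^2 \<Rightarrow> real) set" where
  "V_space \<Omega> = {v \<in> H1 \<Omega>. \<exists>g. has_weak_box \<Omega> v g}"

definition V0_space :: "(real^2) set \<Rightarrow> (real^2 \<Rightarrow> real) set" where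
  "V0_space \<Omega> = {v \<in> V_space \<Omega> \<inter> H10 \<Omega>. \<forall>w\<in>H1 \<Omega>. conormal_trace \<Omega> v w = 0}"

definition V_inner ::
    "real \<Rightarrow> (real^2) set \<Rightarrow> (real^2 \<Rightarrow> real) \<Rightarrow> (real^2 \<Rightarrow> real) \<Rightarrow> real" where
  "V_inner \<delta> \<Omega> v w =
     \<delta> * L2_inner \<Omega> (weak_box \<Omega> v) (weak_box \<Omega> w) + L2_inner \<Omega> (weak_grad \<Omega> v) (weak_grad \<Omega> w)"

definition V_norm :: "real \<Rightarrow> (real^2) set \<Rightarrow> (real^2 \<Rightarrow> real) \<Rightarrow> real" where
  "V_norm \<delta> \<Omega> v = sqrt (V_inner \<delta> \<Omega> v v)"

definition A_form ::
    "real \<Rightarrow> (real^2) set \<Rightarrow> (real^2 \<Rightarrow> real) \<Rightarrow> (real^2 \<Rightarrow> real) \<Rightarrow> real" where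
  "A_form \<delta> \<Omega> v w = V_inner \<delta> \<Omega> v w"

text \<open>Bounded linear functionals on \<open>V\<^sub>0\<close>. Linearity and boundedness force equal values on
  representatives that agree almost everywhere.\<close>

definition V_dual :: "real \<Rightarrow> (real^2) set \<Rightarrow> ((real^2 \<Rightarrow> real) \<Rightarrow> real) set" where
  "V_dual \<delta> \<Omega> = {f.
     (\<forall>v\<in>V0_space \<Omega>. \<forall>w\<in>V0_space \<Omega>. f (\<lambda>x. v x + w x) = f v + f w) \<and>
     (\<forall>c. \<forall>v\<in>V0_space \<Omega>. f (\<lambda>x. c * v x) = c * f v) \<and>
     (\<exists>C. \<forall>v\<in>V0_space \<Omega>. \<bar>f v\<bar> \<le> C * V_norm \<delta> \<Omega> v)}"

definition V_dual_norm :: "real \<Rightarrow> (real^2) set \<Rightarrow> ((real^2 \<Rightarrow> real) \<Rightarrow> real) \<Rightarrow> real" where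
  "V_dual_norm \<delta> \<Omega> f =
     (SUP v\<in>{v \<in> V0_space \<Omega>. \<not> (AE x in lebesgue_on \<Omega>. v x = 0)}. \<bar>f v\<bar> / V_norm \<delta> \<Omega> v)"

end

theory Submission
  imports Defs
begin

text \<open>On \<open>V\<^sub>0\<close> the form \<open>A\<^sup>\<delta>\<close> is the inner product itself, so the theorem is the Riesz
  representation theorem once \<open>V\<^sub>0\<close> is known to be a Hilbert space. The Poincare inequality
  \<open>\<parallel>v\<parallel> \<le> C \<parallel>\<nabla>v\<parallel>\<close> on \<open>H\<^sup>1\<^sub>0(\<Omega>)\<close> makes \<open>\<parallel>\<cdot>\<parallel>\<^sub>V\<close> definite and lets a Cauchy sequence converge in
  \<open>L\<^sup>2\<close> together with its weak gradients and its weak wave operators; the weak identities, the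
  approximation by test functions and the vanishing of the conormal trace all pass to the limit,
  the last one because \<open>div (v\<^sub>x, - v\<^sub>y) = \<box>v\<close> turns it into \<open>(bar \<nabla>v, \<nabla>w) + (\<box>v, w) = 0\<close>.
  The norm estimate follows by testing with \<open>v = u\<close>.\<close>

section \<open>Riesz representation for semi-inner products\<close>

text \<open>Functions that agree almost everywhere are not identified, so \<open>V_inner\<close> is
  only semidefinite on \<open>V0_space\<close>; the Riesz theorem is therefore proved for sets of
  functions with a semi-inner product, and definiteness returns as equality up to null sets in the
  uniqueness claim. A second obstacle is that \<open>weak_grad\<close> and \<open>weak_box\<close>
  are arbitrary choices: the choice for a sum need not be the sum of the choices. Computations use
  explicit witnesses instead, and replacing a witness by the chosen one rests on uniqueness almost
  everywhere, that is, on the fundamental lemma, for which the smooth bumps are built. A bump serves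
  again at the end: the dual norm is a real supremum, informative only if some element of
  \<open>V0_space\<close> is not almost everywhere zero and the quotients are bounded. The Poincare
  inequality enters because \<open>V_norm\<close> has no L2 term; its constant is twice the radius
  of a ball about the origin that contains \<Omega>.\<close>

lemma linear_coefficient_zero:
  fixes a b :: real
  assumes "\<And>t. 0 \<le> 2 * t * a + t\<^sup>2 * b"
  shows "a = 0"
proof (rule ccontr)
  assume "a \<noteq> 0"
  \<comment> \<open>Positive and above \<open>b\<close> whatever the sign of \<open>b\<close>: the
    step \<open>t = - a / c\<close> is legitimate, and replacing \<open>b\<close> by
    \<open>c\<close> bounds the expression by \<open>- a\<^sup>2 / c\<close>.\<close>
  define c where "c = \<bar>b\<bar> + 1"
  have c: "c > 0" "b < c" "b \<le> c" by (auto simp: c_def)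
  have "0 \<le> 2 * (- a / c) * a + (- a / c)\<^sup>2 * b" by (rule assms)
  also have "\<dots> \<le> 2 * (- a / c) * a + (- a / c)\<^sup>2 * c"
    using c by (intro add_left_mono mult_left_mono) auto
  also have "\<dots> = - (a\<^sup>2 / c)"
    using c by (simp add: field_simps power2_eq_square)
  also have "\<dots> < 0"
    using c \<open>a \<noteq> 0\<close> by simp
  finally show False by simp
qed

text \<open>A set of functions with pointwise operations stands in for a Hilbert space type. One
  locale covers scalar and vector-valued L2 as well as \<open>V0_space\<close>; positivity is not
  strict because null functions have seminorm zero.\<close>

locale semi_inner_space =
  fixes V :: "('a \<Rightarrow> 'b::real_vector) set" and B :: "('a \<Rightarrow> 'b) \<Rightarrow> ('a \<Rightarrow> 'b) \<Rightarrow> real"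
  assumes zero_mem: "(\<lambda>x. 0) \<in> V"
    and add_mem: "v \<in> V \<Longrightarrow> w \<in> V \<Longrightarrow> (\<lambda>x. v x + w x) \<in> V"
    and scale_mem: "v \<in> V \<Longrightarrow> (\<lambda>x. c *\<^sub>R v x) \<in> V"
    and sym: "v \<in> V \<Longrightarrow> w \<in> V \<Longrightarrow> B v w = B w v"
    and add_left: "u \<in> V \<Longrightarrow> v \<in> V \<Longrightarrow> w \<in> V \<Longrightarrow> B (\<lambda>x. u x + v x) w = B u w + B v w"
    and scale_left: "v \<in> V \<Longrightarrow> w \<in> V \<Longrightarrow> B (\<lambda>x. c *\<^sub>R v x) w = c * B v w"
    and nonneg: "v \<in> V \<Longrightarrow> 0 \<le> B v v"
begin

definition seminorm :: "('a \<Rightarrow> 'b) \<Rightarrow> real" where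
  "seminorm v = sqrt (B v v)"

lemma seminorm_nonneg: "v \<in> V \<Longrightarrow> 0 \<le> seminorm v"
  by (simp add: seminorm_def nonneg)

lemma seminorm_power2: "v \<in> V \<Longrightarrow> (seminorm v)\<^sup>2 = B v v"
  by (simp add: seminorm_def nonneg)

lemma add_right: "u \<in> V \<Longrightarrow> v \<in> V \<Longrightarrow> w \<in> V \<Longrightarrow> B w (\<lambda>x. u x + v x) = B w u + B w v"
  using add_left[of u v w] sym[of w u] sym[of w v] sym[of w "\<lambda>x. u x + v x"] add_mem by simp

lemma scale_right: "v \<in> V \<Longrightarrow> w \<in> V \<Longrightarrow> B w (\<lambda>x. c *\<^sub>R v x) = c * B w v"
  using scale_left[of v w c] sym[of w v] sym[of w "\<lambda>x. c *\<^sub>R v x"] scale_mem by simp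

lemma diff_eq: "(\<lambda>x. v x - w x) = (\<lambda>x. v x + (-1) *\<^sub>R w x)"
  for v w :: "'a \<Rightarrow> 'b"
  by simp

lemma diff_mem: "v \<in> V \<Longrightarrow> w \<in> V \<Longrightarrow> (\<lambda>x. v x - w x) \<in> V"
  unfolding diff_eq by (intro add_mem scale_mem)

lemma diff_left: "u \<in> V \<Longrightarrow> v \<in> V \<Longrightarrow> w \<in> V \<Longrightarrow> B (\<lambda>x. u x - v x) w = B u w - B v w"
  unfolding diff_eq using add_left[of u "\<lambda>x. (-1) *\<^sub>R v x" w] scale_left[of v w "-1"] scale_mem[of v "-1"]
  by simp

lemma diff_right: "u \<in> V \<Longrightarrow> v \<in> V \<Longrightarrow> w \<in> V \<Longrightarrow> B w (\<lambda>x. u x - v x) = B w u - B w v"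
  using diff_left[of u v w] sym[of w u] sym[of w v] sym[of w "\<lambda>x. u x - v x"] diff_mem by simp

lemma add_scale_self:
  assumes "u \<in> V" "v \<in> V"
  shows "B (\<lambda>x. u x + t *\<^sub>R v x) (\<lambda>x. u x + t *\<^sub>R v x) = B u u + 2 * t * B u v + t\<^sup>2 * B v v"
  using assms by (simp add: add_left add_right scale_left scale_right add_mem scale_mem sym[of v u]
      power2_eq_square algebra_simps)

text \<open>The quadratic in \<open>t\<close> given by \<open>add_scale_self\<close> is nonnegative.
  As \<open>B v v\<close> may vanish for nonzero \<open>v\<close>, the degenerate case is treated
  apart.\<close>

lemma Cauchy_Schwarz:
  assumes "u \<in> V" "v \<in> V"
  shows "\<bar>B u v\<bar> \<le> seminorm u * seminorm v"
proof -
  have q: "0 \<le> B u u + 2 * t * B u v + t\<^sup>2 * B v v" for t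
    using add_scale_self[OF assms, of t] nonneg[of "\<lambda>x. u x + t *\<^sub>R v x"] add_mem scale_mem assms
    by simp
  have "(B u v)\<^sup>2 \<le> B u u * B v v"
  proof (cases "B v v = 0")
    case True
    have "B u v = 0"
    proof (rule ccontr)
      assume "B u v \<noteq> 0"
      then show False
        \<comment> \<open>Without the quadratic term the expression is affine in \<open>t\<close>;
          this \<open>t\<close> gives it the value -1.\<close>
        using q[of "- (B u u + 1) / (2 * B u v)"] True by (simp add: field_simps)
    qed
    then show ?thesis using True by simp
  next
    case False
    then have "B v v > 0" using nonneg[OF assms(2)] by simp
    then show ?thesis
      \<comment> \<open>The minimiser of the quadratic.\<close>
      using q[of "- B u v / B v v"] by (simp add: field_simps power2_eq_square)
  qed
  then have "\<bar>B u v\<bar>\<^sup>2 \<le> (seminorm u * seminorm v)\<^sup>2"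
    by (simp add: power_mult_distrib seminorm_power2 assms)
  then show ?thesis
    by (rule power2_le_imp_le) (simp add: seminorm_nonneg assms)
qed

lemma seminorm_triangle:
  assumes "u \<in> V" "v \<in> V"
  shows "seminorm (\<lambda>x. u x + v x) \<le> seminorm u + seminorm v"
proof (rule power2_le_imp_le)
  have "(seminorm (\<lambda>x. u x + v x))\<^sup>2 = B u u + 2 * B u v + B v v"
    using add_scale_self[OF assms, of 1] assms add_mem by (simp add: seminorm_power2)
  also have "\<dots> \<le> (seminorm u + seminorm v)\<^sup>2"
    using Cauchy_Schwarz[OF assms] assms by (simp add: power2_sum seminorm_power2)
  finally show "(seminorm (\<lambda>x. u x + v x))\<^sup>2 \<le> (seminorm u + seminorm v)\<^sup>2" .
qed (simp add: seminorm_nonneg assms)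

lemma seminorm_minus_commute:
  assumes "u \<in> V" "v \<in> V"
  shows "seminorm (\<lambda>x. u x - v x) = seminorm (\<lambda>x. v x - u x)"
  using assms by (simp add: seminorm_def diff_left diff_right diff_mem)

lemma seminorm_triangle_diff:
  assumes "u \<in> V" "v \<in> V" "w \<in> V"
  shows "seminorm (\<lambda>x. u x - w x) \<le> seminorm (\<lambda>x. u x - v x) + seminorm (\<lambda>x. v x - w x)"
  using seminorm_triangle[of "\<lambda>x. u x - v x" "\<lambda>x. v x - w x"] assms diff_mem by simp

lemma seminorm_le_add_diff:
  assumes "u \<in> V" "v \<in> V"
  shows "seminorm u \<le> seminorm (\<lambda>x. u x - v x) + seminorm v"
  using seminorm_triangle[of "\<lambda>x. u x - v x" v] assms diff_mem by simp

text \<open>Continuity of \<open>B\<close> in one argument, by Cauchy-Schwarz. Every passage to the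
  limit in a weak identity below is an instance.\<close>

lemma tendsto_left:
  assumes "\<And>n. s n \<in> V" "u \<in> V" "w \<in> V" "(\<lambda>n. seminorm (\<lambda>x. s n x - u x)) \<longlonglongrightarrow> 0"
  shows "(\<lambda>n. B (s n) w) \<longlonglongrightarrow> B u w"
proof -
  have "(\<lambda>n. B (s n) w - B u w) \<longlonglongrightarrow> 0"
  proof (rule Lim_null_comparison)
    show "\<forall>\<^sub>F n in sequentially. norm (B (s n) w - B u w) \<le> seminorm (\<lambda>x. s n x - u x) * seminorm w"
      using Cauchy_Schwarz[of "\<lambda>x. s _ x - u x" w] assms diff_left diff_mem
      by (intro always_eventually allI) simp
    show "(\<lambda>n. seminorm (\<lambda>x. s n x - u x) * seminorm w) \<longlonglongrightarrow> 0"
      using tendsto_mult_right[OF assms(4), of "seminorm w"] by simp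
  qed
  then show ?thesis by (rule LIM_zero_cancel)
qed

definition cauchy_complete :: bool where
  "cauchy_complete \<longleftrightarrow> (\<forall>s. (\<forall>n::nat. s n \<in> V) \<longrightarrow>
     (\<forall>e>0. \<exists>N. \<forall>m\<ge>N. \<forall>n\<ge>N. seminorm (\<lambda>x. s m x - s n x) < e) \<longrightarrow>
     (\<exists>u\<in>V. (\<lambda>n. seminorm (\<lambda>x. s n x - u x)) \<longlonglongrightarrow> 0))"

text \<open>The representing element minimises the energy \<open>B v v - 2 f v\<close>; by the parallelogram law
  minimising sequences are Cauchy.\<close>

lemma Riesz_representation:
  assumes "cauchy_complete"
    and f_add: "\<And>v w. v \<in> V \<Longrightarrow> w \<in> V \<Longrightarrow> f (\<lambda>x. v x + w x) = f v + f w"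
    and f_scale: "\<And>c v. v \<in> V \<Longrightarrow> f (\<lambda>x. c *\<^sub>R v x) = c * f v"
    and f_bound: "\<And>v. v \<in> V \<Longrightarrow> \<bar>f v\<bar> \<le> C * seminorm v"
  shows "\<exists>u\<in>V. \<forall>v\<in>V. B u v = f v"
proof -
  define J where "J v = B v v - 2 * f v" for v
  define I where "I = Inf (J ` V)"
  have f_diff: "f (\<lambda>x. v x - w x) = f v - f w" if "v \<in> V" "w \<in> V" for v w
    unfolding diff_eq using that f_add[of v "\<lambda>x. (-1) *\<^sub>R w x"] f_scale[of w "-1"] scale_mem[of w "-1"]
    by simp
  have lower: "- C\<^sup>2 \<le> J v" if "v \<in> V" for v
  proof -
    \<comment> \<open>Completing the square: \<open>J v\<close> is at least
      \<open>(seminorm v)\<^sup>2 - 2 * C * seminorm v\<close>.\<close>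
    have "0 \<le> (seminorm v - C)\<^sup>2" by simp
    then show ?thesis
      using f_bound[OF that] seminorm_power2[OF that]
      by (simp add: J_def power2_diff abs_le_iff algebra_simps)
  qed
  then have bdd: "bdd_below (J ` V)" by (auto intro!: bdd_belowI)
  have I_le: "I \<le> J v" if "v \<in> V" for v
    unfolding I_def using bdd that by (intro cInf_lower) auto
  have "\<exists>v\<in>V. J v < I + inverse (Suc n)" for n
  proof -
    have "Inf (J ` V) < I + inverse (Suc n)" by (simp add: I_def)
    then show ?thesis
      using cInf_lessD[of "J ` V"] zero_mem by auto
  qed
  then obtain s where s: "s n \<in> V" "J (s n) < I + inverse (Suc n)" for n
    by metis
  have par: "B (\<lambda>x. v x - w x) (\<lambda>x. v x - w x) \<le> 2 * J v + 2 * J w - 4 * I"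
    if "v \<in> V" "w \<in> V" for v w
  proof -
    \<comment> \<open>The midpoint has energy at least \<open>I\<close>, so two nearly minimal
      elements must be close to each other.\<close>
    let ?m = "\<lambda>x. (1/2) *\<^sub>R (v x + w x)"
    have "?m \<in> V" using scale_mem[OF add_mem[OF that], of "1/2"] .
    moreover have "4 * J ?m = 2 * J v + 2 * J w - B (\<lambda>x. v x - w x) (\<lambda>x. v x - w x)"
      using that sym[of w v] scale_mem[OF add_mem[OF that], of "1/2"]
        scale_left[OF add_mem[OF that], of ?m "1/2"] scale_right[OF add_mem[OF that] add_mem[OF that], of "1/2"]
        f_scale[OF add_mem[OF that], of "1/2"]
      by (simp add: J_def diff_left diff_right diff_mem add_left add_right add_mem f_add algebra_simps)
    ultimately show ?thesis using I_le[of ?m] by simp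
  qed
  have cau: "\<exists>N. \<forall>m\<ge>N. \<forall>n\<ge>N. seminorm (\<lambda>x. s m x - s n x) < e" if "e > 0" for e
  proof -
    \<comment> \<open>Each of the two excesses over \<open>I\<close> enters \<open>par\<close> with
      the factor 2, so together they stay below four times this bound.\<close>
    obtain N where N: "inverse (real (Suc N)) < e\<^sup>2 / 4"
      using reals_Archimedean[of "e\<^sup>2 / 4"] \<open>e > 0\<close> zero_less_power[OF \<open>e > 0\<close>, of 2] by (metis divide_pos_pos zero_less_numeral)
    have "seminorm (\<lambda>x. s m x - s n x) < e" if "m \<ge> N" "n \<ge> N" for m n
    proof -
      have "inverse (real (Suc m)) \<le> inverse (real (Suc N))" "inverse (real (Suc n)) \<le> inverse (real (Suc N))"
        using that by (auto intro!: le_imp_inverse_le)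
      then have "B (\<lambda>x. s m x - s n x) (\<lambda>x. s m x - s n x) < e\<^sup>2"
        using par[OF s(1)[of m] s(1)[of n]] s(2)[of m] s(2)[of n] N by linarith
      then have "(seminorm (\<lambda>x. s m x - s n x))\<^sup>2 < e\<^sup>2"
        by (simp only: seminorm_power2[OF diff_mem[OF s(1) s(1)]])
      then show ?thesis using \<open>e > 0\<close> by (metis less_imp_le power2_less_imp_less)
    qed
    then show ?thesis by blast
  qed
  have "\<exists>u\<in>V. (\<lambda>n. seminorm (\<lambda>x. s n x - u x)) \<longlonglongrightarrow> 0"
    using assms(1)[unfolded cauchy_complete_def, THEN spec, of s] s(1) cau by simp
  then obtain u where u: "u \<in> V" and lim: "(\<lambda>n. seminorm (\<lambda>x. s n x - u x)) \<longlonglongrightarrow> 0"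
    by (elim bexE)
  have "J u \<le> I"
  proof (rule LIMSEQ_le_const)
    \<comment> \<open>Expanding \<open>J\<close> about \<open>u\<close> replaces a continuity
      argument: the square is dropped and the linear part is at most a constant times the distance
      to \<open>u\<close>.\<close>
    have J_eq: "J (s n) = J u + 2 * (B u (\<lambda>x. s n x - u x) - f (\<lambda>x. s n x - u x)) + (seminorm (\<lambda>x. s n x - u x))\<^sup>2" for n
      using s(1)[of n] u sym[of u "s n"]
      by (simp add: J_def seminorm_power2 diff_mem diff_left diff_right f_diff)
    have le: "J u \<le> I + inverse (Suc n) + 2 * (seminorm u + C) * seminorm (\<lambda>x. s n x - u x)" for n
    proof -
      let ?d = "\<lambda>x. s n x - u x"
      have "- B u ?d \<le> seminorm u * seminorm ?d" "f ?d \<le> C * seminorm ?d"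
        using Cauchy_Schwarz[OF u diff_mem[OF s(1)[of n] u]] f_bound[OF diff_mem[OF s(1)[of n] u]]
        by linarith+
      moreover have "2 * (seminorm u + C) * seminorm ?d = 2 * (seminorm u * seminorm ?d) + 2 * (C * seminorm ?d)"
        by (simp add: algebra_simps)
      ultimately show ?thesis
        using J_eq[of n] s(2)[of n] zero_le_power2[of "seminorm ?d"] by (smt (verit))
    qed
    show "\<exists>N. \<forall>n\<ge>N. J u \<le> I + inverse (Suc n) + 2 * (seminorm u + C) * seminorm (\<lambda>x. s n x - u x)"
      using le by blast
    have "(\<lambda>n. I + inverse (Suc n) + 2 * (seminorm u + C) * seminorm (\<lambda>x. s n x - u x)) \<longlonglongrightarrow> I + 0 + 2 * (seminorm u + C) * 0"
      by (intro tendsto_intros LIMSEQ_inverse_real_of_nat lim)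
    then show "(\<lambda>n. I + inverse (Suc n) + 2 * (seminorm u + C) * seminorm (\<lambda>x. s n x - u x)) \<longlonglongrightarrow> I"
      by simp
  qed
  have "B u v = f v" if v: "v \<in> V" for v
  proof -
    \<comment> \<open>First variation: perturbing the minimiser by \<open>t\<close> times
      \<open>v\<close> cannot lower the energy.\<close>
    have "0 \<le> 2 * t * (B u v - f v) + t\<^sup>2 * B v v" for t
    proof -
      have m: "(\<lambda>x. u x + t *\<^sub>R v x) \<in> V" using u v add_mem scale_mem by simp
      have "J (\<lambda>x. u x + t *\<^sub>R v x) = J u + 2 * t * (B u v - f v) + t\<^sup>2 * B v v"
        using u v by (simp add: J_def add_scale_self f_add f_scale scale_mem algebra_simps)
      then show ?thesis using \<open>J u \<le> I\<close> I_le[OF m] by simp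
    qed
    from linear_coefficient_zero[OF this] show ?thesis by simp
  qed
  with u show ?thesis by blast
qed

end

section \<open>Smooth bump functions\<close>

text \<open>Smoothness via an invariant: a family of differentiable functions closed under partial
  derivatives avoids any formula for iterated derivatives.\<close>

lemma smooth_fun_coinduct:
  assumes "f \<in> S"
    and "\<And>g x. g \<in> S \<Longrightarrow> g differentiable (at x)"
    and "\<And>g i. g \<in> S \<Longrightarrow> partial i g \<in> S"
  shows "smooth_fun f"
proof -
  have "foldr partial is f \<in> S" for "is"
    by (induction "is") (auto simp: assms)
  then show ?thesis using assms(2) by (auto simp: smooth_fun_def)
qed

lemma smooth_fun_differentiable: "smooth_fun f \<Longrightarrow> f differentiable (at x)"
  unfolding smooth_fun_def by (metis foldr.simps(1) id_apply)

lemma smooth_fun_partial: "smooth_fun f \<Longrightarrow> smooth_fun (partial i f)"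
proof -
  assume f: "smooth_fun f"
  have "foldr partial is (partial i f) = foldr partial (is @ [i]) f" for "is"
    by simp
  then show ?thesis using f unfolding smooth_fun_def by metis
qed

lemma partial_eqI: "(f has_derivative D) (at x) \<Longrightarrow> partial i f x = D (axis i 1)"
  unfolding partial_def using frechet_derivative_at by metis

lemma has_derivative_frechet:
  "f differentiable (at x) \<Longrightarrow> (f has_derivative frechet_derivative f (at x)) (at x)"
  by (simp add: frechet_derivative_works)

lemma partial_add:
  "f differentiable (at x) \<Longrightarrow> g differentiable (at x) \<Longrightarrow>
    partial i (\<lambda>x. f x + g x) x = partial i f x + partial i g x"
  by (subst partial_eqI[OF has_derivative_add[OF has_derivative_frechet has_derivative_frechet]])
    (simp_all add: partial_def)

lemma partial_mult:
  "f differentiable (at x) \<Longrightarrow> g differentiable (at x) \<Longrightarrow>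
    partial i (\<lambda>x. f x * g x) x = f x * partial i g x + partial i f x * g x"
  by (subst partial_eqI[OF has_derivative_mult[OF has_derivative_frechet has_derivative_frechet]])
    (simp_all add: partial_def)

lemma partial_const: "partial i (\<lambda>x. c) x = 0"
  by (subst partial_eqI[OF has_derivative_const]) simp

text \<open>The invariant for sums and products. By the product rule a derivative of a product is a
  sum of products, so both operations must be closed off together.\<close>

inductive_set smooth_algebra :: "(real^2 \<Rightarrow> real) set" where
  base: "smooth_fun f \<Longrightarrow> f \<in> smooth_algebra"
| add: "f \<in> smooth_algebra \<Longrightarrow> g \<in> smooth_algebra \<Longrightarrow> (\<lambda>x. f x + g x) \<in> smooth_algebra"
| mult: "f \<in> smooth_algebra \<Longrightarrow> g \<in> smooth_algebra \<Longrightarrow> (\<lambda>x. f x * g x) \<in> smooth_algebra"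

lemma smooth_algebra_differentiable: "f \<in> smooth_algebra \<Longrightarrow> f differentiable (at x)"
  by (induction rule: smooth_algebra.induct) (auto intro: smooth_fun_differentiable)

lemma smooth_algebra_partial: "f \<in> smooth_algebra \<Longrightarrow> partial i f \<in> smooth_algebra"
proof (induction rule: smooth_algebra.induct)
  case (base f)
  then show ?case by (intro smooth_algebra.base smooth_fun_partial)
next
  case (add f g)
  then have "partial i (\<lambda>x. f x + g x) = (\<lambda>x. partial i f x + partial i g x)"
    by (intro ext partial_add smooth_algebra_differentiable)
  with add show ?case by (auto intro: smooth_algebra.add)
next
  case (mult f g)
  then have "partial i (\<lambda>x. f x * g x) = (\<lambda>x. f x * partial i g x + partial i f x * g x)"
    by (intro ext partial_mult smooth_algebra_differentiable)
  with mult show ?case by (auto intro: smooth_algebra.intros)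
qed

lemma smooth_algebra_smooth: "f \<in> smooth_algebra \<Longrightarrow> smooth_fun f"
  by (rule smooth_fun_coinduct) (auto intro: smooth_algebra_differentiable smooth_algebra_partial)

lemma smooth_fun_add: "smooth_fun f \<Longrightarrow> smooth_fun g \<Longrightarrow> smooth_fun (\<lambda>x. f x + g x)"
  by (rule smooth_algebra_smooth[OF smooth_algebra.add[OF smooth_algebra.base smooth_algebra.base]])

lemma smooth_fun_mult: "smooth_fun f \<Longrightarrow> smooth_fun g \<Longrightarrow> smooth_fun (\<lambda>x. f x * g x)"
  by (rule smooth_algebra_smooth[OF smooth_algebra.mult[OF smooth_algebra.base smooth_algebra.base]])

lemma smooth_fun_const: "smooth_fun (\<lambda>x. c)"
proof (rule smooth_fun_coinduct[where S = "range (\<lambda>c x. c)"])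
  show "partial i g \<in> range (\<lambda>c x. c)" if "g \<in> range (\<lambda>c x. c)" for g :: "real^2 \<Rightarrow> real" and i
    using that by (auto simp: partial_const[abs_def])
qed auto

lemma has_derivative_component: "((\<lambda>x::real^2. x $ j) has_derivative (\<lambda>h. h $ j)) (at x)"
  by (rule bounded_linear_imp_has_derivative) (rule bounded_linear_vec_nth)

lemma partial_component: "partial i (\<lambda>x. x $ j) x = (if i = j then 1 else 0)"
  by (subst partial_eqI[OF has_derivative_component]) (auto simp: axis_def)

lemma smooth_fun_component: "smooth_fun (\<lambda>x. x $ j)"
proof (rule smooth_fun_coinduct[where S = "insert (\<lambda>x. x $ j) (range (\<lambda>c x. c))"])
  show "partial i g \<in> insert (\<lambda>x. x $ j) (range (\<lambda>c x. c))"
    if "g \<in> insert (\<lambda>x. x $ j) (range (\<lambda>c x. c))" for g :: "real^2 \<Rightarrow> real" and i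
    using that by (auto simp: partial_const[abs_def] partial_component[abs_def])
  show "g differentiable at x" if "g \<in> insert (\<lambda>x. x $ j) (range (\<lambda>c x. c))" for g :: "real^2 \<Rightarrow> real" and x
    using that by (auto intro: differentiableI has_derivative_component)
qed auto

lemma smooth_fun_continuous_on: "smooth_fun f \<Longrightarrow> continuous_on A f"
  by (meson continuous_at_imp_continuous_on differentiable_imp_continuous_within smooth_fun_differentiable)

text \<open>The derivatives of \<open>t \<mapsto> exp (- 1 / t)\<close>, extended by zero to \<open>t \<le> 0\<close>, are again of the
  following form.\<close>

definition flat :: "real poly \<Rightarrow> real \<Rightarrow> real" where
  "flat P t = (if t \<le> 0 then 0 else poly P (inverse t) * exp (- inverse t))"

lemma poly_exp_tendsto_0: "((\<lambda>s. poly P s * exp (- s)) \<longlongrightarrow> (0::real)) at_top"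
proof -
  have "((\<lambda>s. \<Sum>i\<le>degree P. coeff P i * (s ^ i / exp s)) \<longlongrightarrow> (\<Sum>i\<le>degree P. coeff P i * 0)) at_top"
    by (intro tendsto_intros tendsto_power_div_exp_0)
  then show ?thesis
    by (simp add: poly_altdef sum_distrib_right exp_minus divide_inverse mult.assoc)
qed

text \<open>With \<open>s = 1 / t\<close> one has \<open>d/dt = - s\<^sup>2 d/ds\<close>, which
  turns \<open>P(s) exp (- s)\<close> into \<open>s\<^sup>2 (P - P')(s) exp (- s)\<close>; the
  polynomial \<open>[:0, 0, 1:]\<close> is \<open>s\<^sup>2\<close>. The delicate point is
  \<open>t = 0\<close>.\<close>

lemma flat_has_derivative:
  "(flat P has_real_derivative flat ([:0, 0, 1:] * (P - pderiv P)) t) (at t)"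
proof -
  consider "t < 0" | "t > 0" | "t = 0" by linarith
  then show ?thesis
  proof cases
    case 1
    have "((\<lambda>t. 0) has_real_derivative 0) (at t)" by simp
    then have "(flat P has_real_derivative 0) (at t)"
      by (rule has_field_derivative_transform_within_open[where S = "{..<0}"]) (use 1 in \<open>auto simp: flat_def\<close>)
    then show ?thesis using 1 by (simp add: flat_def)
  next
    case 2
    have "((\<lambda>t. poly P (inverse t) * exp (- inverse t)) has_real_derivative
        flat ([:0, 0, 1:] * (P - pderiv P)) t) (at t)"
      using 2 by (auto simp: flat_def intro!: derivative_eq_intros poly_DERIV DERIV_chain[OF poly_DERIV, unfolded o_def])
        (simp add: field_simps power2_eq_square)
    then show ?thesis
      by (rule has_field_derivative_transform_within_open[where S = "{0<..}"]) (use 2 in \<open>auto simp: flat_def\<close>)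
  next
    case 3
    \<comment> \<open>Dividing by \<open>h\<close> multiplies the polynomial by
      \<open>s = 1 / h\<close>, and the exponential still wins as \<open>s\<close> tends to
      infinity.\<close>
    have "((\<lambda>h. flat P h / h) \<longlongrightarrow> 0) (at_right 0)"
    proof (rule Lim_transform_eventually)
      show "((\<lambda>h. poly ([:0, 1:] * P) (inverse h) * exp (- inverse h)) \<longlongrightarrow> 0) (at_right 0)"
        by (rule filterlim_compose[OF poly_exp_tendsto_0 filterlim_inverse_at_top_right])
      show "\<forall>\<^sub>F h in at_right 0. poly ([:0, 1:] * P) (inverse h) * exp (- inverse h) = flat P h / h"
        by (auto simp: eventually_at_right_less flat_def field_simps intro!: eventually_mono[OF eventually_at_right_less])
    qed
    moreover have "((\<lambda>h. flat P h / h) \<longlongrightarrow> 0) (at_left 0)"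
      by (rule Lim_transform_eventually[OF tendsto_const])
        (auto simp: flat_def eventually_at_left_real intro!: eventually_at_leftI[of "-1"])
    ultimately have "((\<lambda>h. flat P h / h) \<longlongrightarrow> 0) (at 0)"
      by (simp add: filterlim_split_at)
    then show ?thesis using 3 by (simp add: DERIV_def flat_def)
  qed
qed

text \<open>The affine argument stays fixed under differentiation; the polynomial changes, and the
  scalar \<open>a\<close> of the invariant absorbs the chain rule factor.\<close>

lemma smooth_fun_flat_affine: "smooth_fun (\<lambda>x. flat P (c * x $ j + d))"
proof (rule smooth_fun_coinduct[where S = "{\<lambda>x. a * flat P (c * x $ j + d) | a P. True}"])
  let ?Q = "\<lambda>P. [:0, 0, 1:] * (P - pderiv P)"
  have der: "((\<lambda>x::real^2. a * flat P (c * x $ j + d)) has_derivative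
      (\<lambda>h. a * (flat (?Q P) (c * x $ j + d) * (c * h $ j)))) (at x)" for a P x
  proof -
    have "((\<lambda>x::real^2. c * x $ j + d) has_derivative (\<lambda>h. c * h $ j)) (at x)"
      by (auto intro!: derivative_eq_intros has_derivative_component)
    from has_derivative_compose[OF this flat_has_derivative[of P, unfolded has_field_derivative_def]]
    show ?thesis by (rule has_derivative_mult_right)
  qed
  show "g differentiable at x" if "g \<in> {\<lambda>x. a * flat P (c * x $ j + d) | a P. True}" for g x
    using that der unfolding differentiable_def by blast
  show "partial i g \<in> {\<lambda>x. a * flat P (c * x $ j + d) | a P. True}"
    if "g \<in> {\<lambda>x. a * flat P (c * x $ j + d) | a P. True}" for g i
  proof -
    from that obtain a P where g: "g = (\<lambda>x. a * flat P (c * x $ j + d))" by auto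
    have "partial i g = (\<lambda>x. (a * c * (axis i 1 :: real^2) $ j) * flat (?Q P) (c * x $ j + d))"
      unfolding g by (rule ext, subst partial_eqI[OF der]) (simp add: mult_ac)
    then show ?thesis by blast
  qed
qed (force intro: exI[of _ 1])

text \<open>Smooth approximation from below of the indicator of \<open>box a b\<close>.
  \<open>flat 1\<close> is \<open>exp (- 1 / t)\<close> for positive \<open>t\<close>; the factor
  \<open>k\<close> sharpens the edges, since \<open>exp (- 1 / (k t))\<close> tends to 1. The
  arguments are multiplied out to match \<open>smooth_fun_flat_affine\<close>.\<close>

definition bump :: "real^2 \<Rightarrow> real^2 \<Rightarrow> nat \<Rightarrow> real^2 \<Rightarrow> real" where
  "bump a b k x =
     (\<Prod>j\<in>UNIV. flat 1 (real k * x $ j + - (real k * a $ j)) * flat 1 (- real k * x $ j + real k * b $ j))"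

lemma flat_1_bounds: "0 \<le> flat 1 t" "flat 1 t \<le> 1"
  by (auto simp: flat_def)

lemma flat_1_eq_0_iff: "flat 1 t = 0 \<longleftrightarrow> t \<le> 0"
  by (simp add: flat_def)

lemma flat_1_tendsto_1:
  assumes "t > 0"
  shows "(\<lambda>k. flat 1 (real k * t)) \<longlonglongrightarrow> 1"
proof -
  have "(\<lambda>k. exp (- (inverse (real k) * inverse t))) \<longlonglongrightarrow> exp (- (0 * inverse t))"
    by (intro tendsto_intros lim_inverse_n)
  moreover have "\<forall>\<^sub>F k in sequentially. exp (- (inverse (real k) * inverse t)) = flat 1 (real k * t)"
    using eventually_gt_at_top[of 0] by eventually_elim (use assms in \<open>auto simp: flat_def mult_le_0_iff\<close>)
  ultimately have "(\<lambda>k. flat 1 (real k * t)) \<longlonglongrightarrow> exp (- (0 * inverse t))"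
    by (rule Lim_transform_eventually)
  then show ?thesis by simp
qed

lemma bump_bounds: "0 \<le> bump a b k x" "bump a b k x \<le> 1"
  unfolding bump_def by (auto intro!: prod_nonneg prod_le_1 mult_le_one flat_1_bounds mult_nonneg_nonneg)

lemma bump_eq_0_iff:
  assumes "k > 0"
  shows "bump a b k x = 0 \<longleftrightarrow> x \<notin> box a b"
proof -
  have "(real k * x $ j + - (real k * a $ j) \<le> 0) = (x $ j \<le> a $ j)"
    "(- real k * x $ j + real k * b $ j \<le> 0) = (b $ j \<le> x $ j)" for j
    using assms by simp_all
  then show ?thesis
    unfolding bump_def mem_box_cart by (auto simp: flat_1_eq_0_iff not_less)
qed

lemma bump_tendsto: "(\<lambda>k. bump a b k x) \<longlonglongrightarrow> indicator (box a b) x"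
proof (cases "x \<in> box a b")
  case True
  have "(\<lambda>k. \<Prod>j\<in>UNIV. flat 1 (real k * (x $ j - a $ j)) * flat 1 (real k * (b $ j - x $ j)))
      \<longlonglongrightarrow> (\<Prod>j\<in>(UNIV :: 2 set). 1 * 1)"
    using True by (intro tendsto_prod tendsto_mult flat_1_tendsto_1) (auto simp: mem_box_cart)
  then show ?thesis using True by (simp add: bump_def algebra_simps)
next
  case False
  have "\<forall>\<^sub>F k in sequentially. 0 = bump a b k x"
    using eventually_gt_at_top[of 0] by eventually_elim (use False bump_eq_0_iff[of _ a b x] in auto)
  then have "(\<lambda>k. bump a b k x) \<longlonglongrightarrow> 0"
    by (rule Lim_transform_eventually[OF tendsto_const])
  then show ?thesis using False by simp
qed

lemma smooth_fun_bump: "smooth_fun (bump a b k)"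
proof -
  have "bump a b k = (\<lambda>x. (flat 1 (real k * x $ 1 + - (real k * a $ 1)) * flat 1 (- real k * x $ 1 + real k * b $ 1))
      * (flat 1 (real k * x $ 2 + - (real k * a $ 2)) * flat 1 (- real k * x $ 2 + real k * b $ 2)))"
    by (simp add: bump_def fun_eq_iff UNIV_2)
  then show ?thesis
    by (simp only:) (intro smooth_fun_mult smooth_fun_flat_affine)
qed

lemma bump_test_function:
  assumes "k > 0" "cbox a b \<subseteq> \<Omega>"
  shows "bump a b k \<in> test_functions \<Omega>"
proof -
  have "{x. bump a b k x \<noteq> 0} = box a b"
    using bump_eq_0_iff[OF assms(1)] by auto
  moreover have "closure (box a b) \<subseteq> cbox a b"
    by (intro closure_minimal box_subset_cbox closed_cbox)
  ultimately show ?thesis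
    using assms(2) smooth_fun_bump by (auto simp: test_functions_def bounded_subset[OF bounded_box])
qed

section \<open>Stability and boundedness properties of test functions, and the integral of their
  derivatives\<close>

lemma test_function_smooth: "\<phi> \<in> test_functions \<Omega> \<Longrightarrow> smooth_fun \<phi>"
  by (simp add: test_functions_def)

lemma test_function_supportI:
  assumes "\<phi> \<in> test_functions \<Omega>" "smooth_fun \<psi>" "\<And>x. \<psi> x \<noteq> 0 \<Longrightarrow> x \<in> closure {x. \<phi> x \<noteq> 0}"
  shows "\<psi> \<in> test_functions \<Omega>"
proof -
  have "closure {x. \<psi> x \<noteq> 0} \<subseteq> closure {x. \<phi> x \<noteq> 0}"
    using assms(3) by (intro closure_minimal) auto
  moreover from this have "compact (closure {x. \<psi> x \<noteq> 0})"
    using assms(1) bounded_subset[of "closure {x. \<phi> x \<noteq> 0}" "closure {x. \<psi> x \<noteq> 0}"]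
    by (simp add: test_functions_def compact_eq_bounded_closed del: compact_closure)
  ultimately show ?thesis using assms(1,2) by (auto simp: test_functions_def)
qed

lemma test_functions_mono: "\<Omega> \<subseteq> \<Omega>' \<Longrightarrow> test_functions \<Omega> \<subseteq> test_functions \<Omega>'"
  by (auto simp: test_functions_def)

lemma test_function_partial:
  assumes "\<phi> \<in> test_functions \<Omega>"
  shows "partial i \<phi> \<in> test_functions \<Omega>"
proof (rule test_function_supportI[OF assms])
  show "smooth_fun (partial i \<phi>)"
    using assms by (intro smooth_fun_partial test_function_smooth)
  show "x \<in> closure {x. \<phi> x \<noteq> 0}" if "partial i \<phi> x \<noteq> 0" for x
  proof (rule ccontr)
    assume x: "x \<notin> closure {x. \<phi> x \<noteq> 0}"
    have "((\<lambda>x. 0) has_derivative (\<lambda>h. 0)) (at x)" by simp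
    then have "(\<phi> has_derivative (\<lambda>h. 0)) (at x)"
      by (rule has_derivative_transform_within_open[where s = "- closure {x. \<phi> x \<noteq> 0}"])
        (use x closure_subset[of "{x. \<phi> x \<noteq> 0}"] in \<open>auto simp: open_Compl\<close>)
    then have "partial i \<phi> x = 0" by (rule partial_eqI)
    with that show False by simp
  qed
qed

lemma test_function_mult:
  assumes "\<phi> \<in> test_functions \<Omega>" "smooth_fun \<psi>"
  shows "(\<lambda>x. \<psi> x * \<phi> x) \<in> test_functions \<Omega>"
  by (rule test_function_supportI[OF assms(1) smooth_fun_mult[OF assms(2) test_function_smooth[OF assms(1)]]])
    (auto intro: closure_subset[THEN subsetD])

lemma test_function_scale: "\<phi> \<in> test_functions \<Omega> \<Longrightarrow> (\<lambda>x. c * \<phi> x) \<in> test_functions \<Omega>"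
  by (intro test_function_mult smooth_fun_const)

lemma test_function_zero: "(\<lambda>x. 0) \<in> test_functions \<Omega>"
  by (simp add: test_functions_def smooth_fun_const)

lemma test_function_add:
  assumes "\<phi> \<in> test_functions \<Omega>" "\<psi> \<in> test_functions \<Omega>"
  shows "(\<lambda>x. \<phi> x + \<psi> x) \<in> test_functions \<Omega>"
proof -
  have sub: "closure {x. \<phi> x + \<psi> x \<noteq> 0} \<subseteq> closure {x. \<phi> x \<noteq> 0} \<union> closure {x. \<psi> x \<noteq> 0}"
    unfolding closure_Un[symmetric] by (rule closure_mono) auto
  have "bounded ({x. \<phi> x \<noteq> 0} \<union> {x. \<psi> x \<noteq> 0})"
    using assms by (simp add: test_functions_def)
  then have "bounded {x. \<phi> x + \<psi> x \<noteq> 0}"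
    by (rule bounded_subset) auto
  then have "compact (closure {x. \<phi> x + \<psi> x \<noteq> 0})"
    by simp
  moreover have "closure {x. \<phi> x + \<psi> x \<noteq> 0} \<subseteq> \<Omega>"
    using sub assms unfolding test_functions_def by blast
  ultimately show ?thesis
    using assms by (simp add: test_functions_def smooth_fun_add)
qed

lemma test_function_zero_outside: "\<phi> \<in> test_functions \<Omega> \<Longrightarrow> x \<notin> \<Omega> \<Longrightarrow> \<phi> x = 0"
  using closure_subset[of "{x. \<phi> x \<noteq> 0}"] by (auto simp: test_functions_def)

lemma test_function_borel: "\<phi> \<in> test_functions \<Omega> \<Longrightarrow> \<phi> \<in> borel_measurable borel"
  by (intro borel_measurable_continuous_onI smooth_fun_continuous_on test_function_smooth)

lemma test_function_bounded:
  assumes "\<phi> \<in> test_functions \<Omega>"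
  obtains B where "\<And>x. \<bar>\<phi> x\<bar> \<le> B" "B \<ge> 0"
proof -
  let ?K = "closure {x. \<phi> x \<noteq> 0}"
  have "compact (\<phi> ` ?K)"
    using assms by (intro compact_continuous_image smooth_fun_continuous_on test_function_smooth)
      (auto simp: test_functions_def)
  then obtain B where B: "\<And>x. x \<in> ?K \<Longrightarrow> \<bar>\<phi> x\<bar> \<le> B"
    by (force dest: compact_imp_bounded simp: bounded_iff)
  have "\<bar>\<phi> x\<bar> \<le> max B 0" for x
    using B[of x] closure_subset[of "{x. \<phi> x \<noteq> 0}"] by (cases "\<phi> x = 0") auto
  then show ?thesis using that[of "max B 0"] by auto
qed

text \<open>Difference quotients have integral zero by translation invariance of Lebesgue measure,
  and they converge to the partial derivative under a common dominating function.\<close>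

lemma integral_partial_lborel:
  assumes "\<phi> \<in> test_functions UNIV"
  shows "(LINT x|lborel. partial i \<phi> x) = 0"
proof -
  define e :: "real^2" where "e = axis i 1"
  define h where "h n = inverse (real (Suc n))" for n
  define g where "g n x = (\<phi> (h n *\<^sub>R e + x) - \<phi> x) / h n" for n x
  have h: "h n > 0" "h n \<le> 1" for n
    by (auto simp: h_def divide_simps)
  have h_lim: "h \<longlonglongrightarrow> 0" unfolding h_def by (rule LIMSEQ_inverse_real_of_nat)
  have [measurable]: "\<phi> \<in> borel_measurable borel" "partial i \<phi> \<in> borel_measurable borel"
    using test_function_borel test_function_partial assms by blast+
  obtain B where B: "\<And>x. \<bar>partial i \<phi> x\<bar> \<le> B" "B \<ge> 0"
    using test_function_bounded[OF test_function_partial[OF assms]] by blast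
  have "bounded {x. \<phi> x \<noteq> 0}"
    using assms by (auto simp: test_functions_def)
  then obtain R where R: "\<And>x. \<phi> x \<noteq> 0 \<Longrightarrow> norm x \<le> R"
    by (auto simp: bounded_iff)
  have der: "((\<lambda>s. \<phi> (s *\<^sub>R e + x)) has_real_derivative partial i \<phi> (s *\<^sub>R e + x)) (at s)" for s x
  proof -
    let ?F = "frechet_derivative \<phi> (at (s *\<^sub>R e + x))"
    have F: "(\<phi> has_derivative ?F) (at (s *\<^sub>R e + x))"
      using assms by (intro has_derivative_frechet smooth_fun_differentiable test_function_smooth)
    have "((\<lambda>s. s *\<^sub>R e + x) has_derivative (\<lambda>t. t *\<^sub>R e)) (at s)"
      by (auto intro!: derivative_eq_intros)
    from has_derivative_compose[OF this F]
    show ?thesis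
      using linear_cmul[OF has_derivative_linear[OF F]]
      by (simp add: has_field_derivative_def partial_def e_def mult_commute_abs)
  qed
  \<comment> \<open>Inside the ball the mean value theorem applies. Outside, both \<open>x\<close>
    and its translate miss the support, since the shift has length at most 1.\<close>
  have g_bound: "\<bar>g n x\<bar> \<le> B * indicator (cball 0 (R + 1)) x" for n x
  proof (cases "x \<in> cball 0 (R + 1)")
    case True
    obtain z where "\<phi> (h n *\<^sub>R e + x) - \<phi> (0 *\<^sub>R e + x) = (h n - 0) * partial i \<phi> (z *\<^sub>R e + x)"
      using MVT2[OF h(1)[of n], of "\<lambda>s. \<phi> (s *\<^sub>R e + x)", OF der] by blast
    then have "g n x = partial i \<phi> (z *\<^sub>R e + x)"
      using h(1)[of n] by (simp add: g_def)
    then show ?thesis using True B by simp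
  next
    case False
    then have x: "norm x > R + 1" by simp
    have "norm x \<le> norm (h n *\<^sub>R e + x) + norm (h n *\<^sub>R e)"
      using norm_triangle_ineq4[of "h n *\<^sub>R e + x" "h n *\<^sub>R e"] by simp
    moreover have "norm (h n *\<^sub>R e) \<le> 1" using h[of n] by (simp add: e_def)
    ultimately have "\<phi> x = 0" "\<phi> (h n *\<^sub>R e + x) = 0"
      using x R[of x] R[of "h n *\<^sub>R e + x"] by force+
    then show ?thesis using False by (simp add: g_def)
  qed
  obtain B' where B': "\<And>x. \<bar>\<phi> x\<bar> \<le> B'" "B' \<ge> 0" using test_function_bounded[OF assms] by blast
  have int_\<phi>: "integrable lborel \<phi>"
  proof (rule Bochner_Integration.integrable_bound)
    show "integrable lborel (\<lambda>x. B' * indicator (cball 0 R) x :: real)"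
      by (intro integrable_mult_right integrable_real_indicator emeasure_bounded_finite) auto
    have "norm (\<phi> x) \<le> norm (B' * indicator (cball 0 R) x)" for x
      using B' R[of x] by (cases "\<phi> x = 0") auto
    then show "AE x in lborel. norm (\<phi> x) \<le> norm (B' * indicator (cball 0 R) x)" by simp
  qed simp
  have "(LINT x|lborel. g n x) = 0" for n
  proof -
    have "(LINT x|lborel. \<phi> (h n *\<^sub>R e + x)) = (LINT x|lborel. \<phi> x)"
      by (subst (2) lborel_distr_plus[symmetric, of "h n *\<^sub>R e"]) (simp add: integral_distr)
    moreover have "integrable lborel (\<lambda>x. \<phi> (h n *\<^sub>R e + x))"
      using int_\<phi> by (subst (asm) lborel_distr_plus[symmetric, of "h n *\<^sub>R e"]) (simp add: integrable_distr_eq)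
    ultimately show ?thesis
      using int_\<phi> by (simp add: g_def)
  qed
  moreover have "(\<lambda>n. LINT x|lborel. g n x) \<longlonglongrightarrow> (LINT x|lborel. partial i \<phi> x)"
  proof (rule integral_dominated_convergence[where w = "\<lambda>x. B * indicator (cball 0 (R + 1)) x"])
    show "integrable lborel (\<lambda>x. B * indicator (cball 0 (R + 1)) x :: real)"
      by (intro integrable_mult_right integrable_real_indicator emeasure_bounded_finite) auto
    show "AE x in lborel. (\<lambda>n. g n x) \<longlonglongrightarrow> partial i \<phi> x"
    proof (rule AE_I2)
      fix x :: "real^2"
      have "((\<lambda>t. (\<phi> (t *\<^sub>R e + x) - \<phi> x) / t) \<longlongrightarrow> partial i \<phi> x) (at 0)"
        using der[of x 0] by (simp add: DERIV_def)
      then show "(\<lambda>n. g n x) \<longlonglongrightarrow> partial i \<phi> x"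
        unfolding g_def
        by (rule filterlim_compose) (use h h_lim in \<open>auto simp: filterlim_at less_imp_neq[OF h(1), symmetric]\<close>)
    qed
  qed (use g_bound in \<open>auto simp: g_def\<close>)
  ultimately show ?thesis by (simp add: LIMSEQ_const_iff)
qed

section \<open>The fundamental lemma of the calculus of variations\<close>

lemma integral_lebesgue_on_supported:
  fixes g :: "'a::euclidean_space \<Rightarrow> real"
  assumes "g \<in> borel_measurable borel" "\<Omega> \<in> sets lebesgue" "\<And>x. x \<notin> \<Omega> \<Longrightarrow> g x = 0"
  shows "(LINT x|lebesgue_on \<Omega>. g x) = (LINT x|lborel. g x)"
proof -
  have "(\<lambda>x. indicator \<Omega> x *\<^sub>R g x) = g"
    using assms(3) by (auto simp: indicator_def fun_eq_iff)
  then show ?thesis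
    using assms(1,2) by (simp add: integral_restrict_space integral_completion)
qed

lemma integral_partial:
  assumes "open \<Omega>" "\<phi> \<in> test_functions \<Omega>"
  shows "(LINT x|lebesgue_on \<Omega>. partial i \<phi> x) = 0"
proof -
  have "(LINT x|lebesgue_on \<Omega>. partial i \<phi> x) = (LINT x|lborel. partial i \<phi> x)"
    using assms test_function_partial[OF assms(2)]
    by (intro integral_lebesgue_on_supported) (auto intro: test_function_borel test_function_zero_outside)
  then show ?thesis
    using integral_partial_lborel test_functions_mono[of \<Omega> UNIV] assms(2) by auto
qed

text \<open>A Dynkin argument: boxes are stable under intersection and generate the Borel sets, so
  all Borel integrals vanish; null sets extend this to Lebesgue sets, and a density with vanishing
  integrals is zero almost everywhere.\<close>

lemma AE_zero_if_box_integrals_zero: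
  fixes h :: "'a::euclidean_space \<Rightarrow> real"
  assumes h: "integrable lebesgue h"
    and zero: "\<And>a b. set_lebesgue_integral lebesgue (box a b) h = 0"
    and supp: "\<And>x. x \<notin> box c d \<Longrightarrow> h x = 0"
  shows "AE x in lebesgue. h x = 0"
proof (rule sigma_finite_measure.density_zero[OF _ h])
  show "sigma_finite_measure (lebesgue :: 'a measure)"
  proof
    obtain A :: "'a set set" where A: "countable A" "A \<subseteq> sets lborel" "\<Union>A = space lborel"
        "\<forall>a\<in>A. emeasure lborel a \<noteq> \<infinity>"
      using lborel.sigma_finite_countable by blast
    then show "\<exists>A. countable A \<and> A \<subseteq> sets (lebesgue :: 'a measure) \<and> \<Union>A = space lebesgue \<and>
        (\<forall>a\<in>A. emeasure lebesgue a \<noteq> \<infinity>)"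
      by (intro exI[of _ A]) auto
  qed
  have set_int: "set_integrable lebesgue A h" if "A \<in> sets lebesgue" for A
    using integrable_mult_indicator[OF that h] by (simp add: set_integrable_def)
  \<comment> \<open>The complement case of the induction needs the total integral, which by
    \<open>supp\<close> is itself a box integral.\<close>
  have "set_lebesgue_integral lebesgue UNIV h = set_lebesgue_integral lebesgue (box c d) h"
    unfolding set_lebesgue_integral_def using supp
    by (intro Bochner_Integration.integral_cong) (auto simp: indicator_def)
  then have total: "set_lebesgue_integral lebesgue UNIV h = 0" using zero by simp
  let ?G = "range (\<lambda>(a, b). box a b :: 'a set)"
  have sig: "sigma_sets UNIV ?G = sets borel"
    by (subst borel_eq_box) simp
  have borel_zero: "set_lebesgue_integral lebesgue A h = 0" if "A \<in> sets borel" for A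
  proof (rule sigma_sets_induct_disjoint[of ?G UNIV A])
    show "Int_stable ?G"
      unfolding Int_stable_def by (auto simp: box_Int_box)
    show "A \<in> sigma_sets UNIV ?G" using that sig by simp
    show "set_lebesgue_integral lebesgue B h = 0" if "B \<in> ?G" for B
      using that zero by auto
    show "set_lebesgue_integral lebesgue {} h = 0" by (simp add: set_lebesgue_integral_def)
    show "set_lebesgue_integral lebesgue (UNIV - B) h = 0"
      if "B \<in> sigma_sets UNIV ?G" "set_lebesgue_integral lebesgue B h = 0" for B
    proof -
      have B: "B \<in> sets lebesgue" "UNIV - B \<in> sets lebesgue" using that(1) sig by auto
      have "set_lebesgue_integral lebesgue (B \<union> (UNIV - B)) h
          = set_lebesgue_integral lebesgue B h + set_lebesgue_integral lebesgue (UNIV - B) h"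
        by (intro set_integral_Un set_int B) auto
      then show ?thesis using total that(2) by simp
    qed
    show "set_lebesgue_integral lebesgue (\<Union>i. F i) h = 0"
      if "disjoint_family F" "range F \<subseteq> sigma_sets UNIV ?G" "\<And>i. set_lebesgue_integral lebesgue (F i) h = 0"
      for F :: "nat \<Rightarrow> 'a set"
    proof -
      have F: "F i \<in> sets lebesgue" for i using that(2) sig by auto
      have "set_lebesgue_integral lebesgue (\<Union>i. F i) h = (\<Sum>i. set_lebesgue_integral lebesgue (F i) h)"
        using that(1) by (intro lebesgue_integral_countable_add set_int sets.countable_UN)
          (auto simp: F disjoint_family_on_def)
      then show ?thesis using that(3) by simp
    qed
  qed auto
  show "set_lebesgue_integral lebesgue A h = 0" if A: "A \<in> sets lebesgue" for A
  proof -
    \<comment> \<open>A Lebesgue set is a Borel set up to a subset of a Borel null set, which the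
      integral does not see.\<close>
    from A obtain S N N' where A_eq: "A = S \<union> N" and N: "N \<subseteq> N'" "N' \<in> null_sets lborel" and S: "S \<in> sets lborel"
      by (rule sets_completionE)
    have "AE x in lebesgue. x \<notin> N'"
      using N(2) by (intro AE_not_in null_sets_completionI)
    then have "AE x in lebesgue. indicator A x *\<^sub>R h x = indicator S x *\<^sub>R h x"
      by eventually_elim (use N A_eq in \<open>auto simp: indicator_def\<close>)
    then have "set_lebesgue_integral lebesgue A h = set_lebesgue_integral lebesgue S h"
      unfolding set_lebesgue_integral_def
      by (intro integral_cong_AE borel_measurable_integrable integrable_mult_indicator h A)
        (use S in auto)
    then show ?thesis using borel_zero S by simp
  qed
qed

text \<open>Bumps turn the hypothesis into vanishing integrals over boxes with closed hull in
  \<Omega>. The Dynkin lemma wants all boxes, so the function is first cut off to one such box;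
  countably many boxes then exhaust \<Omega>.\<close>

lemma fundamental_lemma:
  assumes \<Omega>: "open \<Omega>" and h: "integrable (lebesgue_on \<Omega>) h"
    and zero: "\<And>\<phi>. \<phi> \<in> test_functions \<Omega> \<Longrightarrow> (LINT x|lebesgue_on \<Omega>. h x * \<phi> x) = 0"
  shows "AE x in lebesgue_on \<Omega>. h x = 0"
proof -
  have [simp]: "\<Omega> \<in> sets lebesgue" using \<Omega> by auto
  define H where "H x = indicator \<Omega> x *\<^sub>R h x" for x
  have H: "integrable lebesgue H"
    using h by (simp add: H_def[abs_def] integrable_restrict_space)
  have box_zero: "set_lebesgue_integral lebesgue (box a b) H = 0" if "cbox a b \<subseteq> \<Omega>" for a b
  proof -
    have "(\<lambda>k. LINT x|lebesgue. bump a b k x *\<^sub>R H x) \<longlonglongrightarrow> (LINT x|lebesgue. indicator (box a b) x *\<^sub>R H x)"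
    proof (rule integral_dominated_convergence[where w = "\<lambda>x. norm (H x)"])
      show "integrable lebesgue (\<lambda>x. norm (H x))" using H by simp
      show "(\<lambda>x. indicator (box a b) x *\<^sub>R H x) \<in> borel_measurable lebesgue"
        by (intro borel_measurable_integrable integrable_mult_indicator H) auto
      have "bump a b k \<in> borel_measurable lebesgue" for k
        using smooth_fun_continuous_on[OF smooth_fun_bump]
        by (intro measurable_completion) (auto intro: borel_measurable_continuous_onI)
      then show "(\<lambda>x. bump a b k x *\<^sub>R H x) \<in> borel_measurable lebesgue" for k
        using borel_measurable_integrable[OF H] by (intro borel_measurable_scaleR)
      show "AE x in lebesgue. (\<lambda>k. bump a b k x *\<^sub>R H x) \<longlonglongrightarrow> indicator (box a b) x *\<^sub>R H x"
        by (intro AE_I2 tendsto_intros bump_tendsto)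
      show "AE x in lebesgue. norm (bump a b k x *\<^sub>R H x) \<le> norm (H x)" for k
        using bump_bounds[of a b k] by (intro AE_I2) (simp add: abs_mult mult_left_le_one_le)
    qed
    moreover have "(LINT x|lebesgue. bump a b k x *\<^sub>R H x) = 0" if "k > 0" for k
    proof -
      have "(LINT x|lebesgue. bump a b k x *\<^sub>R H x) = (LINT x|lebesgue_on \<Omega>. h x * bump a b k x)"
        by (simp add: integral_restrict_space H_def mult_ac)
      also have "\<dots> = 0"
        using that \<open>cbox a b \<subseteq> \<Omega>\<close> by (intro zero bump_test_function)
      finally show ?thesis .
    qed
    then have "\<forall>\<^sub>F k in sequentially. (LINT x|lebesgue. bump a b k x *\<^sub>R H x) = 0"
      by (rule eventually_mono[OF eventually_gt_at_top[of 0]])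
    then have "(\<lambda>k. LINT x|lebesgue. bump a b k x *\<^sub>R H x) \<longlonglongrightarrow> 0"
      by (rule tendsto_eventually)
    ultimately show ?thesis
      unfolding set_lebesgue_integral_def by (rule LIMSEQ_unique)
  qed
  have AE_cbox: "AE x in lebesgue. x \<in> cbox c d \<longrightarrow> H x = 0" if cd: "cbox c d \<subseteq> \<Omega>" for c d
  proof -
    \<comment> \<open>Integrating \<open>Q\<close> over any box amounts to integrating
      \<open>H\<close> over an intersection of boxes, again a box inside
      \<open>cbox c d\<close>.\<close>
    define Q where "Q x = indicator (box c d) x *\<^sub>R H x" for x
    have "AE x in lebesgue. Q x = 0"
    proof (rule AE_zero_if_box_integrals_zero)
      show "integrable lebesgue Q"
        unfolding Q_def[abs_def] by (intro integrable_mult_indicator H) auto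
      show "Q x = 0" if "x \<notin> box c d" for x using that by (simp add: Q_def)
      show "set_lebesgue_integral lebesgue (box a b) Q = 0" for a b
      proof -
        obtain p q where pq: "box a b \<inter> box c d = box p q" by (rule that[OF box_Int_box])
        have "set_lebesgue_integral lebesgue (box a b) Q = set_lebesgue_integral lebesgue (box p q) H"
          unfolding set_lebesgue_integral_def Q_def pq[symmetric]
          by (intro Bochner_Integration.integral_cong) (auto simp: indicator_def)
        also have "\<dots> = 0"
        proof (cases "box p q = {}")
          \<comment> \<open>Only for a nonempty box is \<open>cbox p q\<close> its closure; for an
            empty one \<open>p\<close> and \<open>q\<close> would say nothing about
            \<open>cbox c d\<close>.\<close>
          case False
          have "box c d \<noteq> {}" "box p q \<subseteq> box c d" using False pq by auto
          then have "cbox p q \<subseteq> cbox c d"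
            using closure_mono[of "box p q" "box c d"] False by simp
          then show ?thesis using cd by (intro box_zero) auto
        qed (simp add: set_lebesgue_integral_def)
        finally show ?thesis .
      qed
    qed
    \<comment> \<open>\<open>Q\<close> loses the boundary of the box, which is a null set.\<close>
    moreover have "AE x in lebesgue. x \<notin> cbox c d - box c d"
      using negligible_frontier_interval[of c d] by (intro AE_not_in) (simp add: negligible_iff_null_sets)
    ultimately show ?thesis by eventually_elim (auto simp: Q_def)
  qed
  obtain D where D: "countable D" "D \<subseteq> Pow \<Omega>" "\<And>X. X \<in> D \<Longrightarrow> \<exists>a b. X = cbox a b" "\<Union>D = \<Omega>"
    using open_countable_Union_open_cbox[OF \<Omega>] by metis
  have "AE x in lebesgue. \<forall>X\<in>D. x \<in> X \<longrightarrow> H x = 0"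
  proof (rule AE_ball_countable'[OF _ D(1)])
    fix X assume X: "X \<in> D"
    then obtain a b where "X = cbox a b" using D(3) by blast
    then show "AE x in lebesgue. x \<in> X \<longrightarrow> H x = 0" using AE_cbox[of a b] D(2) X by auto
  qed
  then have "AE x in lebesgue. x \<in> \<Omega> \<longrightarrow> h x = 0"
    by eventually_elim (use D(4) in \<open>auto simp: H_def indicator_def\<close>)
  then show ?thesis by (simp add: AE_restrict_space_iff)
qed

section \<open>Completeness of the space of square-integrable functions\<close>

lemma L2_measurable: "f \<in> L2 \<Omega> \<Longrightarrow> f \<in> borel_measurable (lebesgue_on \<Omega>)"
  by (simp add: L2_def)

lemma L2_integrable_square: "f \<in> L2 \<Omega> \<Longrightarrow> integrable (lebesgue_on \<Omega>) (\<lambda>x. (norm (f x))\<^sup>2)"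
  by (simp add: L2_def)

lemma L2_integrable_inner:
  assumes "f \<in> L2 \<Omega>" "g \<in> L2 \<Omega>"
  shows "integrable (lebesgue_on \<Omega>) (\<lambda>x. f x \<bullet> g x)"
proof (rule Bochner_Integration.integrable_bound)
  show "integrable (lebesgue_on \<Omega>) (\<lambda>x. (norm (f x))\<^sup>2 + (norm (g x))\<^sup>2)"
    using assms by (intro Bochner_Integration.integrable_add L2_integrable_square)
  show "(\<lambda>x. f x \<bullet> g x) \<in> borel_measurable (lebesgue_on \<Omega>)"
    using assms by (intro borel_measurable_inner L2_measurable)
  have "\<bar>f x \<bullet> g x\<bar> \<le> (norm (f x))\<^sup>2 + (norm (g x))\<^sup>2" for x
    using Cauchy_Schwarz_ineq2[of "f x" "g x"] sum_squares_bound[of "norm (f x)" "norm (g x)"]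
      mult_nonneg_nonneg[OF norm_ge_zero[of "f x"] norm_ge_zero[of "g x"]] by linarith
  then show "AE x in lebesgue_on \<Omega>. norm (f x \<bullet> g x) \<le> norm ((norm (f x))\<^sup>2 + (norm (g x))\<^sup>2)"
    by simp
qed

lemma L2_scale:
  assumes "f \<in> L2 \<Omega>"
  shows "(\<lambda>x. c *\<^sub>R f x) \<in> L2 \<Omega>"
  using assms unfolding L2_def by (auto simp: power_mult_distrib)

lemma L2_add:
  assumes "f \<in> L2 \<Omega>" "g \<in> L2 \<Omega>"
  shows "(\<lambda>x. f x + g x) \<in> L2 \<Omega>"
proof -
  have "integrable (lebesgue_on \<Omega>) (\<lambda>x. (norm (f x))\<^sup>2 + 2 * (f x \<bullet> g x) + (norm (g x))\<^sup>2)"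
    using assms
    by (intro Bochner_Integration.integrable_add integrable_mult_right L2_integrable_square L2_integrable_inner)
  moreover have "(norm (f x + g x))\<^sup>2 = (norm (f x))\<^sup>2 + 2 * (f x \<bullet> g x) + (norm (g x))\<^sup>2" for x
    by (simp add: power2_norm_eq_inner inner_add inner_commute)
  ultimately show ?thesis
    using assms unfolding L2_def by auto
qed

interpretation L2: semi_inner_space "L2 \<Omega> :: (real^2 \<Rightarrow> 'b::euclidean_space) set" "L2_inner \<Omega>" for \<Omega>
proof
  show "(\<lambda>x. 0) \<in> L2 \<Omega>" by (simp add: L2_def)
  fix u v w :: "real^2 \<Rightarrow> 'b" and c
  assume vw: "v \<in> L2 \<Omega>" "w \<in> L2 \<Omega>"
  then show "(\<lambda>x. v x + w x) \<in> L2 \<Omega>" by (rule L2_add)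
  show "(\<lambda>x. c *\<^sub>R v x) \<in> L2 \<Omega>" using vw by (simp add: L2_scale)
  show "L2_inner \<Omega> v w = L2_inner \<Omega> w v" by (simp add: L2_inner_def inner_commute)
  show "L2_inner \<Omega> (\<lambda>x. c *\<^sub>R v x) w = c * L2_inner \<Omega> v w" by (simp add: L2_inner_def)
  show "0 \<le> L2_inner \<Omega> v v" by (simp add: L2_inner_def)
  assume u: "u \<in> L2 \<Omega>"
  show "L2_inner \<Omega> (\<lambda>x. u x + v x) w = L2_inner \<Omega> u w + L2_inner \<Omega> v w"
    using u vw by (simp add: L2_inner_def inner_add L2_integrable_inner)
qed

abbreviation L2_norm :: "(real^2) set \<Rightarrow> (real^2 \<Rightarrow> 'b::euclidean_space) \<Rightarrow> real" where
  "L2_norm \<Omega> \<equiv> L2.seminorm \<Omega>"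

lemma L2_inner_cong_AE:
  assumes "u \<in> L2 \<Omega>" "v \<in> L2 \<Omega>" "u' \<in> L2 \<Omega>" "v' \<in> L2 \<Omega>"
    and "AE x in lebesgue_on \<Omega>. u x = u' x" "AE x in lebesgue_on \<Omega>. v x = v' x"
  shows "L2_inner \<Omega> u v = L2_inner \<Omega> u' v'"
  unfolding L2_inner_def
proof (rule integral_cong_AE)
  show "AE x in lebesgue_on \<Omega>. u x \<bullet> v x = u' x \<bullet> v' x"
    using assms(5,6) by eventually_elim simp
qed (intro borel_measurable_inner L2_measurable assms)+

lemma L2_inner_self_nn_integral:
  assumes "f \<in> L2 \<Omega>"
  shows "(\<integral>\<^sup>+x. ennreal ((norm (f x))\<^sup>2) \<partial>lebesgue_on \<Omega>) = ennreal (L2_inner \<Omega> f f)"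
  using nn_integral_eq_integral[OF L2_integrable_square[OF assms]]
  by (simp add: L2_inner_def power2_norm_eq_inner)

lemma L2_I_nn_integral:
  assumes "f \<in> borel_measurable (lebesgue_on \<Omega>)"
    and "(\<integral>\<^sup>+x. ennreal ((norm (f x))\<^sup>2) \<partial>lebesgue_on \<Omega>) \<le> ennreal B"
  shows "f \<in> L2 \<Omega>"
proof -
  have "(\<integral>\<^sup>+x. ennreal ((norm (f x))\<^sup>2) \<partial>lebesgue_on \<Omega>) < \<infinity>"
    using assms(2) by (simp add: le_less_trans[OF _ ennreal_less_top])
  then have "integrable (lebesgue_on \<Omega>) (\<lambda>x. (norm (f x))\<^sup>2)"
    using assms(1) by (intro integrableI_nonneg) auto
  then show ?thesis using assms(1) by (simp add: L2_def)
qed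

lemma L2_norm_eq_0_iff:
  assumes "f \<in> L2 \<Omega>"
  shows "L2_norm \<Omega> f = 0 \<longleftrightarrow> (AE x in lebesgue_on \<Omega>. f x = 0)"
  using integral_nonneg_eq_0_iff_AE[OF L2_integrable_square[OF assms]]
  by (simp add: L2.seminorm_def L2_inner_def power2_norm_eq_inner)

text \<open>The weights \<open>2 ^ k\<close> still leave the squared increments with a finite total
  integral, so their weighted sum is finite almost everywhere. Young's inequality then makes the
  increments themselves absolutely summable, without any finiteness of the measure.\<close>

lemma AE_convergent_of_weighted_squares:
  fixes s :: "nat \<Rightarrow> 'a \<Rightarrow> 'b::euclidean_space"
  assumes [measurable]: "\<And>k. s k \<in> borel_measurable M"
    and le: "\<And>k. (\<integral>\<^sup>+x. ennreal ((norm (s (Suc k) x - s k x))\<^sup>2) \<partial>M) \<le> ennreal ((1/4) ^ k)"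
  shows "AE x in M. convergent (\<lambda>k. s k x)"
proof -
  define d where "d k x = (norm (s (Suc k) x - s k x))\<^sup>2" for k x
  have [measurable]: "d k \<in> borel_measurable M" for k unfolding d_def by measurable
  have "(\<integral>\<^sup>+x. (\<Sum>k. ennreal (2 ^ k * d k x)) \<partial>M) = (\<Sum>k. \<integral>\<^sup>+x. ennreal (2 ^ k * d k x) \<partial>M)"
    by (intro nn_integral_suminf) auto
  also have "\<dots> \<le> (\<Sum>k. ennreal ((1/2) ^ k))"
  proof (intro suminf_le summableI)
    fix k
    have "(\<integral>\<^sup>+x. ennreal (2 ^ k * d k x) \<partial>M) = ennreal (2 ^ k) * (\<integral>\<^sup>+x. ennreal (d k x) \<partial>M)"
      by (subst nn_integral_cmult[symmetric]) (auto simp: ennreal_mult' d_def)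
    also have "\<dots> \<le> ennreal (2 ^ k) * ennreal ((1/4) ^ k)"
      using le[of k] by (intro mult_left_mono) (auto simp: d_def)
    also have "\<dots> = ennreal ((1/2) ^ k)"
      by (simp add: ennreal_mult'[symmetric] power_mult_distrib[symmetric])
    finally show "(\<integral>\<^sup>+x. ennreal (2 ^ k * d k x) \<partial>M) \<le> ennreal ((1/2) ^ k)" .
  qed
  also have "\<dots> = ennreal (\<Sum>k. (1/2) ^ k)"
    by (intro suminf_ennreal2 summable_geometric) auto
  finally have fin: "(\<integral>\<^sup>+x. (\<Sum>k. ennreal (2 ^ k * d k x)) \<partial>M) \<noteq> \<infinity>"
    by (auto simp: top_unique)
  have "AE x in M. (\<Sum>k. ennreal (2 ^ k * d k x)) \<noteq> \<infinity>"
    by (rule nn_integral_noteq_infinite[OF _ fin]) measurable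
  then show ?thesis
  proof eventually_elim
    case (elim x)
    have "summable (\<lambda>k. 2 ^ k * d k x)"
      using elim by (intro summable_suminf_not_top) (auto simp: d_def)
    then have dominant: "summable (\<lambda>k. 2 ^ k * d k x + (1/2) ^ k)"
      by (intro summable_add summable_geometric) auto
    have dominated: "norm (s (Suc k) x - s k x) \<le> 2 ^ k * d k x + (1/2) ^ k" for k
    proof -
      let ?a = "norm (s (Suc k) x - s k x)"
      \<comment> \<open>Expanding this square is the inequality
        \<open>a \<le> 2 ^ k a\<^sup>2 + (1/4) (1/2) ^ k\<close>.\<close>
      have "0 \<le> (1/2) ^ k * (2 ^ k * ?a - 1/2)\<^sup>2" by simp
      also have "\<dots> = 2 ^ k * ?a\<^sup>2 - ?a + (1/4) * (1/2) ^ k"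
        by (simp add: power2_eq_square field_simps)
      also have "(1/4) * (1/2) ^ k \<le> ((1/2) ^ k :: real)" by simp
      finally show ?thesis by (simp add: d_def)
    qed
    have "summable (\<lambda>k. s (Suc k) x - s k x)"
      by (rule summable_comparison_test'[OF dominant]) (rule dominated)
    then have "convergent (\<lambda>n. (\<Sum>k<n. s (Suc k) x - s k x) + s 0 x)"
      by (rule convergent_add[OF _ convergent_const, OF summable_iff_convergent[THEN iffD1]])
    then show ?case by (simp add: sum_lessThan_telescope[of "\<lambda>k. s k x"])
  qed
qed

text \<open>Riesz-Fischer: a fast subsequence converges almost everywhere, and Fatou's lemma turns
  its pointwise limit into the norm limit of the whole sequence.\<close>

lemma L2_complete: "L2.cauchy_complete TYPE('b::euclidean_space) \<Omega>"
  unfolding L2.cauchy_complete_def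
proof (intro allI impI)
  fix s :: "nat \<Rightarrow> real^2 \<Rightarrow> 'b"
  assume "\<forall>n. s n \<in> L2 \<Omega>"
    and cau: "\<forall>e>0. \<exists>N. \<forall>m\<ge>N. \<forall>n\<ge>N. L2_norm \<Omega> (\<lambda>x. s m x - s n x) < e"
  then have s: "s n \<in> L2 \<Omega>" for n by blast
  have nn: "(\<integral>\<^sup>+x. ennreal ((norm (s m x - s n x))\<^sup>2) \<partial>lebesgue_on \<Omega>) \<le> ennreal (e\<^sup>2)"
    if "L2_norm \<Omega> (\<lambda>x. s m x - s n x) < e" for m n e
  proof -
    have "(L2_norm \<Omega> (\<lambda>x. s m x - s n x))\<^sup>2 \<le> e\<^sup>2"
      using that L2.seminorm_nonneg[OF L2.diff_mem[OF s s]] by (intro power_mono) auto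
    then show ?thesis
      by (simp add: L2_inner_self_nn_integral L2.diff_mem s L2.seminorm_power2)
  qed
  have "\<exists>r. \<forall>k. (\<forall>m\<ge>r k. \<forall>n\<ge>r k. L2_norm \<Omega> (\<lambda>x. s m x - s n x) < (1/2) ^ k) \<and> r k < r (Suc k)"
  proof (rule dependent_nat_choice)
    show "\<exists>N. \<forall>m\<ge>N. \<forall>n\<ge>N. L2_norm \<Omega> (\<lambda>x. s m x - s n x) < (1/2) ^ 0"
      using cau by simp
    show "\<exists>N'. (\<forall>m\<ge>N'. \<forall>n\<ge>N'. L2_norm \<Omega> (\<lambda>x. s m x - s n x) < (1/2) ^ Suc k) \<and> N < N'" for N k
    proof -
      have "\<exists>N'. \<forall>m\<ge>N'. \<forall>n\<ge>N'. L2_norm \<Omega> (\<lambda>x. s m x - s n x) < (1/2) ^ Suc k"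
        by (rule cau[rule_format]) simp
      then obtain N' where "\<forall>m\<ge>N'. \<forall>n\<ge>N'. L2_norm \<Omega> (\<lambda>x. s m x - s n x) < (1/2) ^ Suc k"
        by (rule exE)
      \<comment> \<open>The maximum keeps the subsequence strictly increasing. The rate
        \<open>(1/2) ^ k\<close> squares to the \<open>(1/4) ^ k\<close> demanded by the almost
        everywhere criterion.\<close>
      then show ?thesis by (intro exI[of _ "max N' (Suc N)"] conjI allI impI) simp_all
    qed
  qed
  then obtain r where r: "\<And>k m n. m \<ge> r k \<Longrightarrow> n \<ge> r k \<Longrightarrow> L2_norm \<Omega> (\<lambda>x. s m x - s n x) < (1/2) ^ k"
      "\<And>k. r k < r (Suc k)"
    by blast
  have mono: "strict_mono r" using r(2) by (simp add: strict_mono_Suc_iff)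
  \<comment> \<open>Where the subsequence diverges the value is unspecified, but this concerns a
    null set and measurability is not affected.\<close>
  define u where "u x = lim (\<lambda>k. s (r k) x)" for x
  note [measurable] = L2_measurable[OF s]
  have u_meas [measurable]: "u \<in> borel_measurable (lebesgue_on \<Omega>)"
    unfolding u_def by (intro borel_measurable_lim_metric) measurable
  have "AE x in lebesgue_on \<Omega>. convergent (\<lambda>k. s (r k) x)"
  proof (rule AE_convergent_of_weighted_squares)
    show "(\<integral>\<^sup>+x. ennreal ((norm (s (r (Suc k)) x - s (r k) x))\<^sup>2) \<partial>lebesgue_on \<Omega>) \<le> ennreal ((1/4) ^ k)" for k
    proof -
      have "L2_norm \<Omega> (\<lambda>x. s (r (Suc k)) x - s (r k) x) < (1/2) ^ k"
        using r(2)[of k] by (intro r(1)) auto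
      from nn[OF this] show ?thesis
        by (simp add: power2_eq_square power_mult_distrib[symmetric])
    qed
  qed measurable
  then have lim: "AE x in lebesgue_on \<Omega>. (\<lambda>k. s (r k) x) \<longlonglongrightarrow> u x"
    by eventually_elim (simp add: u_def convergent_LIMSEQ_iff)
  have close: "(\<integral>\<^sup>+x. ennreal ((norm (s m x - u x))\<^sup>2) \<partial>lebesgue_on \<Omega>) \<le> ennreal (e\<^sup>2)"
    if m: "\<And>n. n \<ge> N \<Longrightarrow> L2_norm \<Omega> (\<lambda>x. s m x - s n x) < e" for m N e
  proof -
    \<comment> \<open>Fatou with \<open>m\<close> fixed: the pointwise limit along the subsequence
      is written as a lower limit.\<close>
    have "AE x in lebesgue_on \<Omega>. ennreal ((norm (s m x - u x))\<^sup>2)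
        = liminf (\<lambda>k. ennreal ((norm (s m x - s (r k) x))\<^sup>2))"
      using lim
    proof eventually_elim
      case (elim x)
      then have "(\<lambda>k. ennreal ((norm (s m x - s (r k) x))\<^sup>2)) \<longlonglongrightarrow> ennreal ((norm (s m x - u x))\<^sup>2)"
        by (intro tendsto_ennrealI tendsto_intros)
      from lim_imp_Liminf[OF sequentially_bot this] show ?case by (rule HOL.sym)
    qed
    then have "(\<integral>\<^sup>+x. ennreal ((norm (s m x - u x))\<^sup>2) \<partial>lebesgue_on \<Omega>)
        = (\<integral>\<^sup>+x. liminf (\<lambda>k. ennreal ((norm (s m x - s (r k) x))\<^sup>2)) \<partial>lebesgue_on \<Omega>)"
      by (rule nn_integral_cong_AE)
    also have "\<dots> \<le> liminf (\<lambda>k. \<integral>\<^sup>+x. ennreal ((norm (s m x - s (r k) x))\<^sup>2) \<partial>lebesgue_on \<Omega>)"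
      by (intro nn_integral_liminf) measurable
    also have "\<dots> \<le> ennreal (e\<^sup>2)"
    proof (rule Liminf_le)
      show "\<forall>\<^sub>F k in sequentially. (\<integral>\<^sup>+x. ennreal ((norm (s m x - s (r k) x))\<^sup>2) \<partial>lebesgue_on \<Omega>) \<le> ennreal (e\<^sup>2)"
        using eventually_ge_at_top[of N]
        by eventually_elim (intro nn m order_trans[OF _ seq_suble[OF mono]])
    qed simp
    finally show ?thesis .
  qed
  obtain N0 where "\<forall>m\<ge>N0. \<forall>n\<ge>N0. L2_norm \<Omega> (\<lambda>x. s m x - s n x) < 1"
    using cau[rule_format, OF zero_less_one] by (rule exE)
  note N0 = this[rule_format, OF order_refl]
  \<comment> \<open>The limit is square-integrable because it differs from a member of the sequence
    by a square-integrable function.\<close>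
  have "(\<lambda>x. s N0 x - u x) \<in> L2 \<Omega>"
    by (rule L2_I_nn_integral[OF _ close[OF N0]]) measurable
  from L2.diff_mem[OF s[of N0] this] have u: "u \<in> L2 \<Omega>" by simp
  have "(\<lambda>n. L2_norm \<Omega> (\<lambda>x. s n x - u x)) \<longlonglongrightarrow> 0"
  proof (rule LIMSEQ_I)
    fix e :: real assume e: "0 < e"
    then obtain N where "\<forall>m\<ge>N. \<forall>n\<ge>N. L2_norm \<Omega> (\<lambda>x. s m x - s n x) < e / 2"
      using cau[rule_format, OF half_gt_zero] by (meson exE)
    note N = this[rule_format]
    have "L2_norm \<Omega> (\<lambda>x. s m x - u x) < e" if m: "m \<ge> N" for m
    proof -
      have "ennreal ((L2_norm \<Omega> (\<lambda>x. s m x - u x))\<^sup>2) \<le> ennreal ((e/2)\<^sup>2)"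
        using close[OF N[OF m]] by (simp add: L2_inner_self_nn_integral L2.diff_mem s u L2.seminorm_power2)
      then have "(L2_norm \<Omega> (\<lambda>x. s m x - u x))\<^sup>2 \<le> (e/2)\<^sup>2" by simp
      then have "L2_norm \<Omega> (\<lambda>x. s m x - u x) \<le> e/2"
        by (rule power2_le_imp_le) (use e in simp)
      then show ?thesis using e by simp
    qed
    then show "\<exists>no. \<forall>n\<ge>no. norm (L2_norm \<Omega> (\<lambda>x. s n x - u x) - 0) < e"
      using L2.seminorm_nonneg[OF L2.diff_mem[OF s u]] by auto
  qed
  with u show "\<exists>u\<in>L2 \<Omega>. (\<lambda>n. L2_norm \<Omega> (\<lambda>x. s n x - u x)) \<longlonglongrightarrow> 0" by blast
qed

text \<open>Here \<open>d m n\<close> will be the \<open>V_norm\<close> distance and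
  \<open>K\<close> a comparison constant, so that the functions, their gradients and their wave
  operators all receive limits from one Cauchy condition.\<close>

lemma L2_Cauchy_limit:
  fixes s :: "nat \<Rightarrow> real^2 \<Rightarrow> 'b::euclidean_space"
  assumes "\<And>n. s n \<in> L2 \<Omega>"
    and "\<And>m n. L2_norm \<Omega> (\<lambda>x. s m x - s n x) \<le> K * d m n"
    and "\<And>e. e > 0 \<Longrightarrow> \<exists>N. \<forall>m\<ge>N. \<forall>n\<ge>N. d m n < (e::real)"
    and "K > 0"
  obtains u where "u \<in> L2 \<Omega>" "(\<lambda>n. L2_norm \<Omega> (\<lambda>x. s n x - u x)) \<longlonglongrightarrow> 0"
proof -
  have "\<exists>N. \<forall>m\<ge>N. \<forall>n\<ge>N. L2_norm \<Omega> (\<lambda>x. s m x - s n x) < e" if "e > 0" for e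
  proof -
    obtain N where N: "\<forall>m\<ge>N. \<forall>n\<ge>N. d m n < e / K"
      using assms(3)[of "e / K"] \<open>e > 0\<close> \<open>K > 0\<close> by auto
    have "L2_norm \<Omega> (\<lambda>x. s m x - s n x) < e" if "m \<ge> N" "n \<ge> N" for m n
    proof -
      have "K * d m n < e" using N that \<open>K > 0\<close> by (simp add: pos_less_divide_eq mult.commute)
      with assms(2)[of m n] show ?thesis by simp
    qed
    then show ?thesis by blast
  qed
  then have "\<exists>u\<in>L2 \<Omega>. (\<lambda>n. L2_norm \<Omega> (\<lambda>x. s n x - u x)) \<longlonglongrightarrow> 0"
    using L2_complete[unfolded L2.cauchy_complete_def, THEN spec, of s] assms(1) by simp
  then show ?thesis using that by (elim bexE)
qed

section \<open>Weak derivatives and the Poincare inequality\<close>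

lemma L2_dominated:
  assumes "f \<in> L2 \<Omega>" "h \<in> borel_measurable (lebesgue_on \<Omega>)" "\<And>x. norm (h x) \<le> norm (f x)"
  shows "h \<in> L2 \<Omega>"
proof -
  have "integrable (lebesgue_on \<Omega>) (\<lambda>x. (norm (h x))\<^sup>2)"
  proof (rule Bochner_Integration.integrable_bound[OF L2_integrable_square[OF assms(1)]])
    show "AE x in lebesgue_on \<Omega>. norm ((norm (h x))\<^sup>2) \<le> norm ((norm (f x))\<^sup>2)"
      using assms(3) by (intro AE_I2) (simp add: power_mono)
  qed (use assms(2) in measurable)
  then show ?thesis using assms(2) by (simp add: L2_def)
qed

lemma L2_component:
  fixes G :: "real^2 \<Rightarrow> real^2"
  assumes "G \<in> L2 \<Omega>"
  shows "(\<lambda>x. G x $ i) \<in> L2 \<Omega>"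
proof (rule L2_dominated[OF assms])
  show "(\<lambda>x. G x $ i) \<in> borel_measurable (lebesgue_on \<Omega>)"
    unfolding cart_eq_inner_axis
    by (intro borel_measurable_inner measurable_const L2_measurable assms) simp
qed (simp add: component_le_norm_cart)

lemma L2_axis:
  assumes "g \<in> L2 \<Omega>"
  shows "(\<lambda>x. g x *\<^sub>R (axis i 1 :: real^2)) \<in> L2 \<Omega>"
  using assms by (rule L2_dominated) (auto intro!: borel_measurable_scaleR L2_measurable[OF assms])

definition grad :: "(real^2 \<Rightarrow> real) \<Rightarrow> real^2 \<Rightarrow> real^2" where
  "grad \<phi> x = (\<chi> i. partial i \<phi> x)"

definition wave :: "(real^2 \<Rightarrow> real) \<Rightarrow> real^2 \<Rightarrow> real" where
  "wave \<phi> x = partial 1 (partial 1 \<phi>) x - partial 2 (partial 2 \<phi>) x"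

text \<open>Rewriting the weak identities as L2 inner products makes linearity and continuity of the
  semi-inner product available for them; the \<open>i\<close>-th component is picked out by pairing
  with \<open>\<phi>\<close> times a unit vector.\<close>

lemma has_weak_gradient_iff:
  "has_weak_gradient \<Omega> v G \<longleftrightarrow> G \<in> L2 \<Omega> \<and>
    (\<forall>\<phi>\<in>test_functions \<Omega>. \<forall>i. L2_inner \<Omega> v (partial i \<phi>) = - L2_inner \<Omega> G (\<lambda>x. \<phi> x *\<^sub>R axis i 1))"
  by (simp add: has_weak_gradient_def L2_inner_def inner_axis mult.commute)

lemma has_weak_box_iff:
  "has_weak_box \<Omega> v g \<longleftrightarrow> g \<in> L2 \<Omega> \<and>
    (\<forall>\<phi>\<in>test_functions \<Omega>. L2_inner \<Omega> v (wave \<phi>) = L2_inner \<Omega> g \<phi>)"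
  by (simp add: has_weak_box_def L2_inner_def wave_def)

lemma has_weak_div_iff:
  "has_weak_div \<Omega> F d \<longleftrightarrow> d \<in> L2 \<Omega> \<and>
    (\<forall>\<phi>\<in>test_functions \<Omega>. L2_inner \<Omega> F (grad \<phi>) = - L2_inner \<Omega> d \<phi>)"
  by (simp add: has_weak_div_def L2_inner_def inner_vec_def sum_2 grad_def)

lemma bar_nth [simp]: "bar p $ 1 = p $ 1" "bar p $ 2 = - p $ 2"
  by (simp_all add: bar_def)

lemma norm_bar: "norm (bar p) = norm p"
  by (simp add: norm_eq_sqrt_inner inner_vec_def sum_2)

lemma inner_bar: "bar p \<bullet> q = p \<bullet> bar q"
  by (simp add: inner_vec_def sum_2)

lemma linear_bar: "linear bar"
  by (rule linearI) (simp_all add: vec_eq_iff forall_2)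

lemma L2_bar:
  assumes "G \<in> L2 \<Omega>"
  shows "(\<lambda>x. bar (G x)) \<in> L2 \<Omega>"
proof (rule L2_dominated[OF assms])
  have "bar \<in> borel_measurable borel"
    by (intro borel_measurable_continuous_onI linear_continuous_on) (simp add: linear_bar linear_conv_bounded_linear[symmetric])
  then show "(\<lambda>x. bar (G x)) \<in> borel_measurable (lebesgue_on \<Omega>)"
    using measurable_compose[OF L2_measurable[OF assms]] by blast
qed (simp add: norm_bar)

lemma L2_inner_bar: "L2_inner \<Omega> (\<lambda>x. bar (G x)) H = L2_inner \<Omega> G (\<lambda>x. bar (H x))"
  by (simp add: L2_inner_def inner_bar)

locale bounded_open =
  fixes \<Omega> :: "(real^2) set"
  assumes open_\<Omega>: "open \<Omega>" and bounded_\<Omega>: "bounded \<Omega>"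
begin

lemma sets_\<Omega>: "\<Omega> \<in> sets lebesgue"
  using open_\<Omega> by auto

lemma L2_bounded_borel:
  fixes f :: "real^2 \<Rightarrow> 'b::euclidean_space"
  assumes "f \<in> borel_measurable borel" "\<And>x. norm (f x) \<le> B"
  shows "f \<in> L2 \<Omega>"
proof -
  have m: "f \<in> borel_measurable (lebesgue_on \<Omega>)"
    using assms(1) by (intro measurable_restrict_space1 measurable_completion) simp
  have "finite_measure (lebesgue_on \<Omega>)"
    using bounded_\<Omega> sets_\<Omega> by (intro finite_measure_lebesgue_on) (simp add: bounded_set_imp_lmeasurable)
  then have "integrable (lebesgue_on \<Omega>) (\<lambda>x. (norm (f x))\<^sup>2)"
    using m assms(2) by (intro finite_measure.integrable_const_bound[where B = "B\<^sup>2"])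
      (auto intro!: AE_I2 power_mono)
  with m show ?thesis by (simp add: L2_def)
qed

lemma test_function_L2: "\<phi> \<in> test_functions \<Omega> \<Longrightarrow> \<phi> \<in> L2 \<Omega>"
  by (metis L2_bounded_borel real_norm_def test_function_borel test_function_bounded)

lemma partial_L2: "\<phi> \<in> test_functions \<Omega> \<Longrightarrow> partial i \<phi> \<in> L2 \<Omega>"
  by (intro test_function_L2 test_function_partial)

lemma wave_test_function:
  assumes "\<phi> \<in> test_functions \<Omega>"
  shows "wave \<phi> \<in> test_functions \<Omega>"
proof -
  have "wave \<phi> = (\<lambda>x. partial 1 (partial 1 \<phi>) x + (-1) * partial 2 (partial 2 \<phi>) x)"
    by (simp add: wave_def fun_eq_iff)
  then show ?thesis
    using assms by (simp only:) (intro test_function_add test_function_scale test_function_partial)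
qed

lemma grad_eq: "grad \<phi> = (\<lambda>x. partial 1 \<phi> x *\<^sub>R axis 1 1 + partial 2 \<phi> x *\<^sub>R axis 2 1)"
  by (simp add: fun_eq_iff grad_def vec_eq_iff forall_2 axis_def)

lemma grad_L2: "\<phi> \<in> test_functions \<Omega> \<Longrightarrow> grad \<phi> \<in> L2 \<Omega>"
  unfolding grad_eq by (intro L2_add L2_axis partial_L2)

lemma L2_fundamental:
  assumes "f \<in> L2 \<Omega>" "\<And>\<phi>. \<phi> \<in> test_functions \<Omega> \<Longrightarrow> L2_inner \<Omega> f \<phi> = 0"
  shows "AE x in lebesgue_on \<Omega>. f x = 0"
proof (rule fundamental_lemma[OF open_\<Omega>])
  \<comment> \<open>On a bounded set the constant 1 is square-integrable, and pairing with it shows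
    that \<open>f\<close> is integrable.\<close>
  have "(\<lambda>x::real^2. 1::real) \<in> L2 \<Omega>" by (rule L2_bounded_borel[of _ 1]) auto
  from L2_integrable_inner[OF assms(1) this] show "integrable (lebesgue_on \<Omega>) f" by simp
  show "(LINT x|lebesgue_on \<Omega>. f x * \<phi> x) = 0" if "\<phi> \<in> test_functions \<Omega>" for \<phi>
    using assms(2)[OF that] by (simp add: L2_inner_def)
qed

lemma L2_AE_eqI:
  assumes "f \<in> L2 \<Omega>" "g \<in> L2 \<Omega>"
    and "\<And>\<phi>. \<phi> \<in> test_functions \<Omega> \<Longrightarrow> L2_inner \<Omega> f \<phi> = L2_inner \<Omega> g \<phi>"
  shows "AE x in lebesgue_on \<Omega>. f x = g x"
proof -
  have "AE x in lebesgue_on \<Omega>. f x - g x = 0"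
    using assms by (intro L2_fundamental L2.diff_mem) (simp_all add: L2.diff_left test_function_L2)
  then show ?thesis by simp
qed

lemma has_weak_box_unique:
  "has_weak_box \<Omega> v g \<Longrightarrow> has_weak_box \<Omega> v g' \<Longrightarrow> AE x in lebesgue_on \<Omega>. g x = g' x"
  unfolding has_weak_box_iff by (intro L2_AE_eqI) auto

lemma has_weak_div_unique:
  "has_weak_div \<Omega> F d \<Longrightarrow> has_weak_div \<Omega> F d' \<Longrightarrow> AE x in lebesgue_on \<Omega>. d x = d' x"
  unfolding has_weak_div_iff by (intro L2_AE_eqI) auto

lemma has_weak_gradient_unique:
  assumes "has_weak_gradient \<Omega> v G" "has_weak_gradient \<Omega> v G'"
  shows "AE x in lebesgue_on \<Omega>. G x = G' x"
proof -
  have "AE x in lebesgue_on \<Omega>. G x $ i = G' x $ i" for i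
    using assms by (intro L2_AE_eqI L2_component) (auto simp: has_weak_gradient_def L2_inner_def)
  then have "AE x in lebesgue_on \<Omega>. \<forall>i. G x $ i = G' x $ i"
    by (simp add: AE_all_countable)
  then show ?thesis by (simp add: vec_eq_iff)
qed

lemma has_weak_gradient_add:
  assumes "v \<in> L2 \<Omega>" "w \<in> L2 \<Omega>" "has_weak_gradient \<Omega> v G" "has_weak_gradient \<Omega> w H"
  shows "has_weak_gradient \<Omega> (\<lambda>x. v x + w x) (\<lambda>x. G x + H x)"
  using assms unfolding has_weak_gradient_iff
  by (auto simp: L2.add_left L2.add_mem L2_axis test_function_L2 partial_L2)

lemma has_weak_gradient_scale:
  assumes "v \<in> L2 \<Omega>" "has_weak_gradient \<Omega> v G"
  shows "has_weak_gradient \<Omega> (\<lambda>x. c *\<^sub>R v x) (\<lambda>x. c *\<^sub>R G x)"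
  using assms unfolding has_weak_gradient_iff
  by (auto simp: L2.scale_left L2.scale_mem L2_axis test_function_L2 partial_L2 simp del: real_scaleR_def)

lemma has_weak_box_add:
  assumes "v \<in> L2 \<Omega>" "w \<in> L2 \<Omega>" "has_weak_box \<Omega> v g" "has_weak_box \<Omega> w h"
  shows "has_weak_box \<Omega> (\<lambda>x. v x + w x) (\<lambda>x. g x + h x)"
  using assms unfolding has_weak_box_iff
  by (auto simp: L2.add_left L2.add_mem test_function_L2 wave_test_function)

lemma has_weak_box_scale:
  assumes "v \<in> L2 \<Omega>" "has_weak_box \<Omega> v g"
  shows "has_weak_box \<Omega> (\<lambda>x. c *\<^sub>R v x) (\<lambda>x. c *\<^sub>R g x)"
  using assms unfolding has_weak_box_iff
  by (auto simp: L2.scale_left L2.scale_mem test_function_L2 wave_test_function simp del: real_scaleR_def)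

lemma integration_by_parts:
  assumes "\<phi> \<in> test_functions \<Omega>" "\<psi> \<in> test_functions \<Omega>"
  shows "L2_inner \<Omega> \<phi> (partial i \<psi>) = - L2_inner \<Omega> (partial i \<phi>) \<psi>"
proof -
  have "0 = (LINT x|lebesgue_on \<Omega>. partial i (\<lambda>x. \<phi> x * \<psi> x) x)"
    using assms by (intro integral_partial[symmetric] open_\<Omega> test_function_mult test_function_smooth)
  also have "\<dots> = (LINT x|lebesgue_on \<Omega>. \<phi> x \<bullet> partial i \<psi> x + partial i \<phi> x \<bullet> \<psi> x)"
    using assms by (simp add: partial_mult smooth_fun_differentiable test_function_smooth)
  also have "\<dots> = L2_inner \<Omega> \<phi> (partial i \<psi>) + L2_inner \<Omega> (partial i \<phi>) \<psi>"
    unfolding L2_inner_def using assms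
    by (intro Bochner_Integration.integral_add L2_integrable_inner test_function_L2 partial_L2)
  finally show ?thesis by simp
qed

lemma has_weak_gradient_grad: "\<phi> \<in> test_functions \<Omega> \<Longrightarrow> has_weak_gradient \<Omega> \<phi> (grad \<phi>)"
  unfolding has_weak_gradient_iff
  by (simp add: grad_L2 integration_by_parts) (simp add: L2_inner_def grad_def inner_axis mult.commute)

lemma wave_L2_inner:
  assumes "\<phi> \<in> test_functions \<Omega>" "v \<in> L2 \<Omega>"
  shows "L2_inner \<Omega> v (wave \<phi>)
    = L2_inner \<Omega> v (partial 1 (partial 1 \<phi>)) - L2_inner \<Omega> v (partial 2 (partial 2 \<phi>))"
  unfolding wave_def[abs_def] using assms
  by (intro L2.diff_right partial_L2 test_function_partial)

text \<open>One integration by parts on each side reduces both expressions to inner products of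
  first derivatives, which are symmetric in the two test functions.\<close>

lemma has_weak_box_wave:
  assumes "\<phi> \<in> test_functions \<Omega>"
  shows "has_weak_box \<Omega> \<phi> (wave \<phi>)"
proof -
  have "L2_inner \<Omega> \<phi> (wave \<psi>) = L2_inner \<Omega> (wave \<phi>) \<psi>" if "\<psi> \<in> test_functions \<Omega>" for \<psi>
  proof -
    have "L2_inner \<Omega> (wave \<phi>) \<psi> = L2_inner \<Omega> \<psi> (wave \<phi>)"
      using assms that by (intro L2.sym test_function_L2 wave_test_function)
    then show ?thesis
      using assms that L2.sym[of "partial _ \<phi>" \<Omega> "partial _ \<psi>"]
      by (simp add: wave_L2_inner test_function_L2 integration_by_parts test_function_partial partial_L2)
  qed
  then show ?thesis
    using assms by (simp add: has_weak_box_iff test_function_L2 wave_test_function)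
qed

text \<open>Integrating \<open>\<partial>\<^sub>1 (x\<^sub>1 \<phi>\<^sup>2)\<close> over the domain gives \<open>(\<phi>, \<phi>) = - 2 (x\<^sub>1 \<phi>, \<partial>\<^sub>1 \<phi>)\<close>.\<close>

lemma Poincare_test_function:
  assumes "\<phi> \<in> test_functions \<Omega>" and R: "\<And>x. x \<in> \<Omega> \<Longrightarrow> norm x \<le> R"
  shows "L2_norm \<Omega> \<phi> \<le> 2 * \<bar>R\<bar> * L2_norm \<Omega> (grad \<phi>)"
proof -
  define \<psi> where "\<psi> x = x $ 1 * \<phi> x" for x :: "real^2"
  have \<psi>: "\<psi> \<in> test_functions \<Omega>"
    unfolding \<psi>_def[abs_def] using assms by (intro test_function_mult smooth_fun_component)
  have \<phi>: "\<phi> \<in> L2 \<Omega>" "partial 1 \<phi> \<in> L2 \<Omega>" "grad \<phi> \<in> L2 \<Omega>" "\<psi> \<in> L2 \<Omega>"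
    using assms \<psi> by (auto intro: test_function_L2 partial_L2 grad_L2)
  have \<psi>_bound: "L2_norm \<Omega> \<psi> \<le> \<bar>R\<bar> * L2_norm \<Omega> \<phi>"
  proof (rule power2_le_imp_le)
    have "\<bar>x $ 1 * \<phi> x\<bar> \<le> \<bar>R * \<phi> x\<bar>" for x
    proof (cases "x \<in> \<Omega>")
      case True
      then have "\<bar>x $ 1\<bar> \<le> \<bar>R\<bar>" using R[OF True] component_le_norm_cart[of x 1] by simp
      then show ?thesis by (simp add: abs_mult mult_right_mono)
    qed (use test_function_zero_outside[OF assms(1)] in simp)
    then have "L2_inner \<Omega> \<psi> \<psi> \<le> (LINT x|lebesgue_on \<Omega>. R\<^sup>2 * (\<phi> x \<bullet> \<phi> x))"
      unfolding L2_inner_def \<psi>_def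
      by (intro integral_mono integrable_mult_right L2_integrable_inner \<phi> \<phi>(4)[unfolded \<psi>_def[abs_def]])
        (simp add: power2_eq_square[symmetric] abs_le_square_iff[symmetric] power_mult_distrib[symmetric])
    also have "\<dots> = R\<^sup>2 * L2_inner \<Omega> \<phi> \<phi>" by (simp add: L2_inner_def)
    finally show "(L2_norm \<Omega> \<psi>)\<^sup>2 \<le> (\<bar>R\<bar> * L2_norm \<Omega> \<phi>)\<^sup>2"
      using \<phi> by (simp add: L2.seminorm_power2 power_mult_distrib)
  qed (simp add: L2.seminorm_nonneg \<phi>)
  have partial_bound: "L2_norm \<Omega> (partial 1 \<phi>) \<le> L2_norm \<Omega> (grad \<phi>)"
  proof (rule power2_le_imp_le)
    have "L2_inner \<Omega> (partial 1 \<phi>) (partial 1 \<phi>) \<le> L2_inner \<Omega> (grad \<phi>) (grad \<phi>)"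
      unfolding L2_inner_def
      by (intro integral_mono L2_integrable_inner \<phi>) (simp add: grad_def inner_vec_def sum_2)
    then show "(L2_norm \<Omega> (partial 1 \<phi>))\<^sup>2 \<le> (L2_norm \<Omega> (grad \<phi>))\<^sup>2"
      using \<phi> by (simp add: L2.seminorm_power2)
  qed (simp add: L2.seminorm_nonneg \<phi>)
  \<comment> \<open>The product rule for \<open>\<psi>\<close> makes the left side reappear on the
    right, together with the squared norm of \<open>\<phi>\<close>.\<close>
  have "L2_inner \<Omega> \<psi> (partial 1 \<phi>) = - L2_inner \<Omega> (partial 1 \<psi>) \<phi>"
    by (rule integration_by_parts[OF \<psi> assms(1)])
  also have "L2_inner \<Omega> (partial 1 \<psi>) \<phi> = (LINT x|lebesgue_on \<Omega>. \<psi> x \<bullet> partial 1 \<phi> x + \<phi> x \<bullet> \<phi> x)"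
    unfolding L2_inner_def \<psi>_def[abs_def] using assms
    by (simp add: partial_mult partial_component smooth_fun_differentiable test_function_smooth
        smooth_fun_component algebra_simps)
  also have "\<dots> = L2_inner \<Omega> \<psi> (partial 1 \<phi>) + L2_inner \<Omega> \<phi> \<phi>"
    unfolding L2_inner_def by (intro Bochner_Integration.integral_add L2_integrable_inner \<phi>)
  finally have "(L2_norm \<Omega> \<phi>)\<^sup>2 = - 2 * L2_inner \<Omega> \<psi> (partial 1 \<phi>)"
    by (simp add: L2.seminorm_power2 \<phi>)
  also have "\<dots> \<le> 2 * (L2_norm \<Omega> \<psi> * L2_norm \<Omega> (partial 1 \<phi>))"
    using L2.Cauchy_Schwarz[OF \<phi>(4,2)] by simp
  also have "\<dots> \<le> 2 * ((\<bar>R\<bar> * L2_norm \<Omega> \<phi>) * L2_norm \<Omega> (grad \<phi>))"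
    by (intro mult_left_mono mult_mono \<psi>_bound partial_bound) (simp_all add: L2.seminorm_nonneg \<phi>)
  \<comment> \<open>Arranged so that one factor \<open>L2_norm \<Omega> \<phi>\<close> cancels,
    unless it is zero.\<close>
  finally have sq: "L2_norm \<Omega> \<phi> * L2_norm \<Omega> \<phi> \<le> (2 * \<bar>R\<bar> * L2_norm \<Omega> (grad \<phi>)) * L2_norm \<Omega> \<phi>"
    by (simp add: power2_eq_square mult_ac)
  show ?thesis
  proof (cases "L2_norm \<Omega> \<phi> = 0")
    case True
    then show ?thesis by (simp add: L2.seminorm_nonneg \<phi>)
  next
    case False
    then have "L2_norm \<Omega> \<phi> > 0" using L2.seminorm_nonneg[OF \<phi>(1)] by simp
    with sq show ?thesis by (rule mult_right_le_imp_le)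
  qed
qed

section \<open>Independence of the choices of weak derivatives, and the conormal trace\<close>

lemma has_weak_gradient_L2: "has_weak_gradient \<Omega> v G \<Longrightarrow> G \<in> L2 \<Omega>"
  by (simp add: has_weak_gradient_def)

lemma has_weak_box_L2: "has_weak_box \<Omega> v g \<Longrightarrow> g \<in> L2 \<Omega>"
  by (simp add: has_weak_box_def)

lemma has_weak_gradient_weak_grad: "has_weak_gradient \<Omega> v G \<Longrightarrow> has_weak_gradient \<Omega> v (weak_grad \<Omega> v)"
  unfolding weak_grad_def by (rule someI[of "has_weak_gradient \<Omega> v"])

lemma has_weak_box_weak_box: "has_weak_box \<Omega> v g \<Longrightarrow> has_weak_box \<Omega> v (weak_box \<Omega> v)"
  unfolding weak_box_def by (rule someI[of "has_weak_box \<Omega> v"])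

lemma weak_grad_AE:
  "has_weak_gradient \<Omega> v G \<Longrightarrow> AE x in lebesgue_on \<Omega>. weak_grad \<Omega> v x = G x"
  using has_weak_gradient_unique has_weak_gradient_weak_grad by blast

lemma weak_box_AE: "has_weak_box \<Omega> v g \<Longrightarrow> AE x in lebesgue_on \<Omega>. weak_box \<Omega> v x = g x"
  using has_weak_box_unique has_weak_box_weak_box by blast

lemma weak_grad_inner_cong:
  assumes "has_weak_gradient \<Omega> v G" "has_weak_gradient \<Omega> w H"
  shows "L2_inner \<Omega> (weak_grad \<Omega> v) (weak_grad \<Omega> w) = L2_inner \<Omega> G H"
  using assms
  by (intro L2_inner_cong_AE weak_grad_AE has_weak_gradient_L2) (auto intro: has_weak_gradient_weak_grad)

lemma weak_box_inner_cong:
  assumes "has_weak_box \<Omega> v g" "has_weak_box \<Omega> w h"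
  shows "L2_inner \<Omega> (weak_box \<Omega> v) (weak_box \<Omega> w) = L2_inner \<Omega> g h"
  using assms
  by (intro L2_inner_cong_AE weak_box_AE has_weak_box_L2) (auto intro: has_weak_box_weak_box)

lemma H1_norm_eq:
  assumes "has_weak_gradient \<Omega> v G" "v \<in> L2 \<Omega>"
  shows "H1_norm \<Omega> v = sqrt ((L2_norm \<Omega> v)\<^sup>2 + (L2_norm \<Omega> G)\<^sup>2)"
  using assms has_weak_gradient_L2[OF assms(1)]
  by (simp add: H1_norm_def weak_grad_inner_cong L2.seminorm_power2)

lemma has_weak_gradient_diff_test:
  assumes "has_weak_gradient \<Omega> v G" "v \<in> L2 \<Omega>" "\<phi> \<in> test_functions \<Omega>"
  shows "has_weak_gradient \<Omega> (\<lambda>x. v x - \<phi> x) (\<lambda>x. G x - grad \<phi> x)"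
  using has_weak_gradient_add[OF assms(2) L2.scale_mem[OF test_function_L2[OF assms(3)], of "-1"] assms(1)
      has_weak_gradient_scale[OF test_function_L2[OF assms(3)] has_weak_gradient_grad[OF assms(3)], of "-1"]]
  by simp

text \<open>\<open>bar\<close> is symmetric, so it can be moved onto the gradient of the test
  function; the weak gradient identity is then tested with the first derivatives of
  \<open>\<phi>\<close>, which produces the wave operator.\<close>

lemma has_weak_div_bar_gradient:
  assumes "has_weak_gradient \<Omega> v G" "has_weak_box \<Omega> v g" "v \<in> L2 \<Omega>"
  shows "has_weak_div \<Omega> (\<lambda>x. bar (G x)) g"
proof -
  have "L2_inner \<Omega> (\<lambda>x. bar (G x)) (grad \<phi>) = - L2_inner \<Omega> g \<phi>" if \<phi>: "\<phi> \<in> test_functions \<Omega>" for \<phi>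
  proof -
    have G: "G \<in> L2 \<Omega>" using assms(1) by (rule has_weak_gradient_L2)
    have bar_grad: "(\<lambda>x. bar (grad \<phi> x)) = (\<lambda>x. partial 1 \<phi> x *\<^sub>R axis 1 1 - partial 2 \<phi> x *\<^sub>R axis 2 1)"
      by (simp add: fun_eq_iff vec_eq_iff forall_2 grad_def axis_def)
    have "L2_inner \<Omega> (\<lambda>x. bar (G x)) (grad \<phi>)
        = L2_inner \<Omega> G (\<lambda>x. partial 1 \<phi> x *\<^sub>R axis 1 1) - L2_inner \<Omega> G (\<lambda>x. partial 2 \<phi> x *\<^sub>R axis 2 1)"
      unfolding L2_inner_bar bar_grad using G \<phi> by (intro L2.diff_right L2_axis partial_L2)
    also have "\<dots> = - L2_inner \<Omega> v (partial 1 (partial 1 \<phi>)) + L2_inner \<Omega> v (partial 2 (partial 2 \<phi>))"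
      using assms(1) \<phi> by (simp add: has_weak_gradient_iff test_function_partial)
    also have "\<dots> = - L2_inner \<Omega> v (wave \<phi>)"
      using \<phi> assms(3) by (simp add: wave_L2_inner)
    also have "\<dots> = - L2_inner \<Omega> g \<phi>"
      using assms(2) \<phi> by (simp add: has_weak_box_iff)
    finally show ?thesis .
  qed
  then show ?thesis using assms(2) by (simp add: has_weak_div_iff has_weak_box_L2)
qed

text \<open>Removes every choice from the trace: what remains is linear and L2-continuous in the
  pair of \<open>G\<close> and \<open>g\<close>, so its vanishing survives sums and limits.\<close>

lemma conormal_trace_eq:
  assumes v: "has_weak_gradient \<Omega> v G" "has_weak_box \<Omega> v g" "v \<in> L2 \<Omega>"
    and w: "has_weak_gradient \<Omega> w H" "w \<in> L2 \<Omega>"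
  shows "conormal_trace \<Omega> v w = L2_inner \<Omega> G (\<lambda>x. bar (H x)) + L2_inner \<Omega> g w"
proof -
  let ?F = "\<lambda>x. bar (weak_grad \<Omega> v x)"
  have div: "has_weak_div \<Omega> ?F g"
    using has_weak_div_bar_gradient[OF has_weak_gradient_weak_grad] v by blast
  then have div': "has_weak_div \<Omega> ?F (weak_div \<Omega> ?F)"
    unfolding weak_div_def by (rule someI[of "has_weak_div \<Omega> ?F"])
  have "L2_inner \<Omega> (weak_div \<Omega> ?F) w = L2_inner \<Omega> g w"
    using div div' w has_weak_div_unique[OF div' div]
    by (intro L2_inner_cong_AE) (auto simp: has_weak_div_def)
  moreover have "L2_inner \<Omega> ?F (weak_grad \<Omega> w) = L2_inner \<Omega> (\<lambda>x. bar (G x)) H"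
  proof (intro L2_inner_cong_AE L2_bar has_weak_gradient_L2)
    show "AE x in lebesgue_on \<Omega>. ?F x = bar (G x)"
      using weak_grad_AE[OF v(1)] by eventually_elim simp
  qed (use v w in \<open>auto intro: has_weak_gradient_weak_grad weak_grad_AE\<close>)
  ultimately show ?thesis
    by (simp add: conormal_trace_def normal_trace_def L2_inner_bar)
qed

text \<open>Carries the weak gradient and the weak wave operator as explicit arguments, so that sums and limits
  do not run into the choices made by \<open>weak_grad\<close> and \<open>weak_box\<close>.\<close>

definition V0_data :: "(real^2 \<Rightarrow> real) \<Rightarrow> (real^2 \<Rightarrow> real^2) \<Rightarrow> (real^2 \<Rightarrow> real) \<Rightarrow> bool" where
  "V0_data v G g \<longleftrightarrow> v \<in> L2 \<Omega> \<and> has_weak_gradient \<Omega> v G \<and> has_weak_box \<Omega> v g \<and>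
     (\<exists>\<phi>. (\<forall>k::nat. \<phi> k \<in> test_functions \<Omega>) \<and>
       (\<lambda>k. L2_norm \<Omega> (\<lambda>x. v x - \<phi> k x)) \<longlonglongrightarrow> 0 \<and> (\<lambda>k. L2_norm \<Omega> (\<lambda>x. G x - grad (\<phi> k) x)) \<longlonglongrightarrow> 0) \<and>
     (\<forall>w H. w \<in> L2 \<Omega> \<longrightarrow> has_weak_gradient \<Omega> w H \<longrightarrow>
        L2_inner \<Omega> G (\<lambda>x. bar (H x)) + L2_inner \<Omega> g w = 0)"

lemma V0_dataD:
  assumes "V0_data v G g"
  shows "v \<in> L2 \<Omega>" "G \<in> L2 \<Omega>" "g \<in> L2 \<Omega>" "has_weak_gradient \<Omega> v G" "has_weak_box \<Omega> v g"
  using assms by (auto simp: V0_data_def has_weak_gradient_def has_weak_box_def)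

lemma V0_dataI:
  assumes "v \<in> L2 \<Omega>" "has_weak_gradient \<Omega> v G" "has_weak_box \<Omega> v g"
    and "\<And>k::nat. \<phi> k \<in> test_functions \<Omega>"
    and "(\<lambda>k. L2_norm \<Omega> (\<lambda>x. v x - \<phi> k x)) \<longlonglongrightarrow> 0" "(\<lambda>k. L2_norm \<Omega> (\<lambda>x. G x - grad (\<phi> k) x)) \<longlonglongrightarrow> 0"
    and "\<And>w H. w \<in> L2 \<Omega> \<Longrightarrow> has_weak_gradient \<Omega> w H \<Longrightarrow>
        L2_inner \<Omega> G (\<lambda>x. bar (H x)) + L2_inner \<Omega> g w = 0"
  shows "V0_data v G g"
  unfolding V0_data_def by (intro conjI exI[of _ \<phi>] allI impI assms)

lemma V0_dataE:
  assumes "V0_data v G g"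
  obtains \<phi> where "\<And>k::nat. \<phi> k \<in> test_functions \<Omega>"
    "(\<lambda>k. L2_norm \<Omega> (\<lambda>x. v x - \<phi> k x)) \<longlonglongrightarrow> 0" "(\<lambda>k. L2_norm \<Omega> (\<lambda>x. G x - grad (\<phi> k) x)) \<longlonglongrightarrow> 0"
proof -
  from assms have "\<exists>\<phi>. (\<forall>k::nat. \<phi> k \<in> test_functions \<Omega>) \<and>
      (\<lambda>k. L2_norm \<Omega> (\<lambda>x. v x - \<phi> k x)) \<longlonglongrightarrow> 0 \<and> (\<lambda>k. L2_norm \<Omega> (\<lambda>x. G x - grad (\<phi> k) x)) \<longlonglongrightarrow> 0"
    by (simp add: V0_data_def)
  then show thesis by (elim exE conjE) (rule that, simp_all)
qed

text \<open>\<open>H1_norm\<close> uses the chosen gradient of each difference; uniqueness replaces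
  it by \<open>G - grad (\<phi> k)\<close>, and convergence splits into two L2 statements.\<close>

lemma H1_norm_tendsto_iff:
  assumes "has_weak_gradient \<Omega> v G" "v \<in> L2 \<Omega>" "\<And>k. \<phi> k \<in> test_functions \<Omega>"
  shows "((\<lambda>k. H1_norm \<Omega> (\<lambda>x. v x - \<phi> k x)) \<longlonglongrightarrow> 0) \<longleftrightarrow>
    ((\<lambda>k. L2_norm \<Omega> (\<lambda>x. v x - \<phi> k x)) \<longlonglongrightarrow> 0) \<and> ((\<lambda>k. L2_norm \<Omega> (\<lambda>x. G x - grad (\<phi> k) x)) \<longlonglongrightarrow> 0)"
proof -
  define a where "a k = L2_norm \<Omega> (\<lambda>x. v x - \<phi> k x)" for k
  define b where "b k = L2_norm \<Omega> (\<lambda>x. G x - grad (\<phi> k) x)" for k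
  have nonneg: "0 \<le> a k" "0 \<le> b k" for k
    unfolding a_def b_def
    by (intro L2.seminorm_nonneg L2.diff_mem assms(2) has_weak_gradient_L2[OF assms(1)]
        test_function_L2[OF assms(3)] grad_L2[OF assms(3)])+
  have H1: "H1_norm \<Omega> (\<lambda>x. v x - \<phi> k x) = sqrt ((a k)\<^sup>2 + (b k)\<^sup>2)" for k
    unfolding a_def b_def
    by (rule H1_norm_eq[OF has_weak_gradient_diff_test[OF assms] L2.diff_mem[OF assms(2) test_function_L2[OF assms(3)]]])
  have "(\<lambda>k. sqrt ((a k)\<^sup>2 + (b k)\<^sup>2)) \<longlonglongrightarrow> 0 \<longleftrightarrow> a \<longlonglongrightarrow> 0 \<and> b \<longlonglongrightarrow> 0"
  proof (intro iffI conjI)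
    assume lim: "(\<lambda>k. sqrt ((a k)\<^sup>2 + (b k)\<^sup>2)) \<longlonglongrightarrow> 0"
    show "a \<longlonglongrightarrow> 0"
      by (rule Lim_null_comparison[OF _ lim]) (simp add: nonneg real_le_rsqrt)
    show "b \<longlonglongrightarrow> 0"
      by (rule Lim_null_comparison[OF _ lim]) (simp add: nonneg real_le_rsqrt)
  next
    assume "a \<longlonglongrightarrow> 0 \<and> b \<longlonglongrightarrow> 0"
    then have "(\<lambda>k. sqrt ((a k)\<^sup>2 + (b k)\<^sup>2)) \<longlonglongrightarrow> sqrt (0\<^sup>2 + 0\<^sup>2)"
      by (intro tendsto_intros) auto
    then show "(\<lambda>k. sqrt ((a k)\<^sup>2 + (b k)\<^sup>2)) \<longlonglongrightarrow> 0" by simp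
  qed
  then show ?thesis by (simp add: H1 a_def[abs_def] b_def[abs_def])
qed

text \<open>With \<open>V0_spaceI\<close> this passes between membership and explicit witnesses: out
  of the space with the chosen derivatives, back into it with any.\<close>

lemma V0_space_data:
  assumes "v \<in> V0_space \<Omega>"
  shows "V0_data v (weak_grad \<Omega> v) (weak_box \<Omega> v)"
proof -
  from assms have v: "v \<in> L2 \<Omega>" and G: "has_weak_gradient \<Omega> v (weak_grad \<Omega> v)"
    and g: "has_weak_box \<Omega> v (weak_box \<Omega> v)"
    by (auto simp: V0_space_def V_space_def H1_def intro: has_weak_gradient_weak_grad has_weak_box_weak_box)
  obtain \<phi> where \<phi>: "\<And>k::nat. \<phi> k \<in> test_functions \<Omega>" "(\<lambda>k. H1_norm \<Omega> (\<lambda>x. v x - \<phi> k x)) \<longlonglongrightarrow> 0"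
    using assms by (auto simp: V0_space_def H10_def)
  have "L2_inner \<Omega> (weak_grad \<Omega> v) (\<lambda>x. bar (H x)) + L2_inner \<Omega> (weak_box \<Omega> v) w = 0"
    if "w \<in> L2 \<Omega>" "has_weak_gradient \<Omega> w H" for w H
  proof -
    have "w \<in> H1 \<Omega>" using that by (auto simp: H1_def)
    then have "conormal_trace \<Omega> v w = 0" using assms by (simp add: V0_space_def)
    then show ?thesis using conormal_trace_eq[OF G g v that(2,1)] by simp
  qed
  moreover have "(\<lambda>k. L2_norm \<Omega> (\<lambda>x. v x - \<phi> k x)) \<longlonglongrightarrow> 0"
      "(\<lambda>k. L2_norm \<Omega> (\<lambda>x. weak_grad \<Omega> v x - grad (\<phi> k) x)) \<longlonglongrightarrow> 0"
    using \<phi>(2) H1_norm_tendsto_iff[of v _ \<phi>, OF G v \<phi>(1)] by simp_all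
  ultimately show ?thesis
    by (intro V0_dataI[of v _ _ \<phi>] v G g \<phi>(1))
qed

lemma V0_spaceI:
  assumes "V0_data v G g"
  shows "v \<in> V0_space \<Omega>"
proof -
  note D = V0_dataD[OF assms]
  obtain \<phi> where \<phi>: "\<And>k::nat. \<phi> k \<in> test_functions \<Omega>"
      "(\<lambda>k. L2_norm \<Omega> (\<lambda>x. v x - \<phi> k x)) \<longlonglongrightarrow> 0" "(\<lambda>k. L2_norm \<Omega> (\<lambda>x. G x - grad (\<phi> k) x)) \<longlonglongrightarrow> 0"
    using V0_dataE[OF assms] by blast
  have H1: "v \<in> H1 \<Omega>" using D by (auto simp: H1_def)
  moreover have "(\<lambda>k. H1_norm \<Omega> (\<lambda>x. v x - \<phi> k x)) \<longlonglongrightarrow> 0"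
    using \<phi>(2,3) H1_norm_tendsto_iff[of v G \<phi>, OF D(4,1) \<phi>(1)] by simp
  ultimately have "v \<in> H10 \<Omega>"
    using H1 \<phi>(1) unfolding H10_def by (intro CollectI conjI exI[of _ \<phi>] allI)
  moreover have "conormal_trace \<Omega> v w = 0" if "w \<in> H1 \<Omega>" for w
  proof -
    obtain H where "w \<in> L2 \<Omega>" "has_weak_gradient \<Omega> w H" using \<open>w \<in> H1 \<Omega>\<close> by (auto simp: H1_def)
    then show ?thesis
      using conormal_trace_eq[OF D(4,5,1)] assms by (simp add: V0_data_def)
  qed
  ultimately show ?thesis using H1 D by (auto simp: V0_space_def V_space_def)
qed

section \<open>Linearity of the data, test functions as members, and closedness under L2
  limits\<close>

lemma V0_data_add:
  assumes "V0_data v G g" "V0_data w H h"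
  shows "V0_data (\<lambda>x. v x + w x) (\<lambda>x. G x + H x) (\<lambda>x. g x + h x)"
proof -
  note D = V0_dataD[OF assms(1)] V0_dataD[OF assms(2)]
  obtain \<phi> where \<phi>: "\<And>k::nat. \<phi> k \<in> test_functions \<Omega>"
      "(\<lambda>k. L2_norm \<Omega> (\<lambda>x. v x - \<phi> k x)) \<longlonglongrightarrow> 0" "(\<lambda>k. L2_norm \<Omega> (\<lambda>x. G x - grad (\<phi> k) x)) \<longlonglongrightarrow> 0"
    using V0_dataE[OF assms(1)] by blast
  obtain \<psi> where \<psi>: "\<And>k::nat. \<psi> k \<in> test_functions \<Omega>"
      "(\<lambda>k. L2_norm \<Omega> (\<lambda>x. w x - \<psi> k x)) \<longlonglongrightarrow> 0" "(\<lambda>k. L2_norm \<Omega> (\<lambda>x. H x - grad (\<psi> k) x)) \<longlonglongrightarrow> 0"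
    using V0_dataE[OF assms(2)] by blast
  have grad_add: "grad (\<lambda>x. \<phi> k x + \<psi> k x) = (\<lambda>x. grad (\<phi> k) x + grad (\<psi> k) x)" for k
    using \<phi>(1)[of k] \<psi>(1)[of k]
    by (simp add: fun_eq_iff grad_def vec_eq_iff partial_add smooth_fun_differentiable test_function_smooth)
  \<comment> \<open>The codomain is left general because this is applied to the functions and to
    their gradients.\<close>
  have sum_lim: "(\<lambda>k. L2_norm \<Omega> (\<lambda>x. (a x + b x) - (p k x + q k x))) \<longlonglongrightarrow> 0"
    if "(\<lambda>k. L2_norm \<Omega> (\<lambda>x. a x - p k x)) \<longlonglongrightarrow> 0" "(\<lambda>k. L2_norm \<Omega> (\<lambda>x. b x - q k x)) \<longlonglongrightarrow> 0"
      and mem: "a \<in> L2 \<Omega>" "b \<in> L2 \<Omega>" "\<And>k. p k \<in> L2 \<Omega>" "\<And>k. q k \<in> L2 \<Omega>"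
    for a b :: "real^2 \<Rightarrow> 'b::euclidean_space" and p q :: "nat \<Rightarrow> real^2 \<Rightarrow> 'b"
  proof (rule Lim_null_comparison)
    show "(\<lambda>k. L2_norm \<Omega> (\<lambda>x. a x - p k x) + L2_norm \<Omega> (\<lambda>x. b x - q k x)) \<longlonglongrightarrow> 0"
      using tendsto_add[OF that(1,2)] by simp
    have "L2_norm \<Omega> (\<lambda>x. (a x + b x) - (p k x + q k x))
        \<le> L2_norm \<Omega> (\<lambda>x. a x - p k x) + L2_norm \<Omega> (\<lambda>x. b x - q k x)" for k
      using L2.seminorm_triangle[OF L2.diff_mem[OF mem(1,3)] L2.diff_mem[OF mem(2,4)], of k k]
      by (simp add: algebra_simps)
    then show "\<forall>\<^sub>F k in sequentially. norm (L2_norm \<Omega> (\<lambda>x. (a x + b x) - (p k x + q k x)))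
        \<le> L2_norm \<Omega> (\<lambda>x. a x - p k x) + L2_norm \<Omega> (\<lambda>x. b x - q k x)"
      using L2.seminorm_nonneg[OF L2.diff_mem[OF L2.add_mem[OF mem(1,2)] L2.add_mem[OF mem(3,4)]]]
      by (intro always_eventually allI) simp
  qed
  show ?thesis
  proof (rule V0_dataI)
    show "(\<lambda>x. \<phi> k x + \<psi> k x) \<in> test_functions \<Omega>" for k by (intro test_function_add \<phi> \<psi>)
    show "(\<lambda>k. L2_norm \<Omega> (\<lambda>x. (v x + w x) - (\<phi> k x + \<psi> k x))) \<longlonglongrightarrow> 0"
      by (intro sum_lim \<phi> \<psi> D test_function_L2)
    show "(\<lambda>k. L2_norm \<Omega> (\<lambda>x. (G x + H x) - grad (\<lambda>x. \<phi> k x + \<psi> k x) x)) \<longlonglongrightarrow> 0"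
      unfolding grad_add by (intro sum_lim \<phi> \<psi> D grad_L2)
    show "L2_inner \<Omega> (\<lambda>x. G x + H x) (\<lambda>x. bar (K x)) + L2_inner \<Omega> (\<lambda>x. g x + h x) z = 0"
      if "z \<in> L2 \<Omega>" "has_weak_gradient \<Omega> z K" for z K
    proof -
      have "L2_inner \<Omega> G (\<lambda>x. bar (K x)) + L2_inner \<Omega> g z = 0" "L2_inner \<Omega> H (\<lambda>x. bar (K x)) + L2_inner \<Omega> h z = 0"
        using assms that by (auto simp: V0_data_def)
      then show ?thesis
        using D that L2_bar[OF has_weak_gradient_L2[OF that(2)]] by (simp add: L2.add_left)
    qed
  qed (intro L2.add_mem has_weak_gradient_add has_weak_box_add D)+
qed

lemma V0_data_scale:
  assumes "V0_data v G g"
  shows "V0_data (\<lambda>x. c *\<^sub>R v x) (\<lambda>x. c *\<^sub>R G x) (\<lambda>x. c *\<^sub>R g x)"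
proof -
  note D = V0_dataD[OF assms]
  obtain \<phi> where \<phi>: "\<And>k::nat. \<phi> k \<in> test_functions \<Omega>"
      "(\<lambda>k. L2_norm \<Omega> (\<lambda>x. v x - \<phi> k x)) \<longlonglongrightarrow> 0" "(\<lambda>k. L2_norm \<Omega> (\<lambda>x. G x - grad (\<phi> k) x)) \<longlonglongrightarrow> 0"
    using V0_dataE[OF assms] by blast
  have grad_scale: "grad (\<lambda>x. c * \<phi> k x) = (\<lambda>x. c *\<^sub>R grad (\<phi> k) x)" for k
    using \<phi>(1)[of k]
    by (simp add: fun_eq_iff grad_def vec_eq_iff partial_mult partial_const smooth_fun_differentiable test_function_smooth)
  have scale_lim: "(\<lambda>k. L2_norm \<Omega> (\<lambda>x. c *\<^sub>R a x - c *\<^sub>R p k x)) \<longlonglongrightarrow> 0"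
    if "(\<lambda>k. L2_norm \<Omega> (\<lambda>x. a x - p k x)) \<longlonglongrightarrow> 0" and mem: "a \<in> L2 \<Omega>" "\<And>k. p k \<in> L2 \<Omega>"
    for a :: "real^2 \<Rightarrow> 'b::euclidean_space" and p :: "nat \<Rightarrow> real^2 \<Rightarrow> 'b"
  proof -
    have "L2_norm \<Omega> (\<lambda>x. c *\<^sub>R a x - c *\<^sub>R p k x) = \<bar>c\<bar> * L2_norm \<Omega> (\<lambda>x. a x - p k x)" for k
    proof -
      let ?d = "\<lambda>x. a x - p k x"
      have "L2_inner \<Omega> (\<lambda>x. c *\<^sub>R ?d x) (\<lambda>x. c *\<^sub>R ?d x) = c\<^sup>2 * L2_inner \<Omega> ?d ?d"
        using L2.diff_mem[OF mem, of k] L2.scale_mem[OF L2.diff_mem[OF mem, of k]]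
        by (simp only: L2.scale_left L2.scale_right power2_eq_square mult.assoc)
      then show ?thesis
        by (simp add: scaleR_diff_right L2.seminorm_def real_sqrt_mult)
    qed
    then show ?thesis using tendsto_mult_right_zero[OF that(1)] by simp
  qed
  show ?thesis
  proof (rule V0_dataI)
    show "(\<lambda>x. c * \<phi> k x) \<in> test_functions \<Omega>" for k by (intro test_function_scale \<phi>)
    show "(\<lambda>k. L2_norm \<Omega> (\<lambda>x. c *\<^sub>R v x - c * \<phi> k x)) \<longlonglongrightarrow> 0"
      using scale_lim[OF \<phi>(2) D(1) test_function_L2[OF \<phi>(1)]] by simp
    show "(\<lambda>k. L2_norm \<Omega> (\<lambda>x. c *\<^sub>R G x - grad (\<lambda>x. c * \<phi> k x) x)) \<longlonglongrightarrow> 0"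
      unfolding grad_scale by (intro scale_lim \<phi> D grad_L2)
    show "L2_inner \<Omega> (\<lambda>x. c *\<^sub>R G x) (\<lambda>x. bar (K x)) + L2_inner \<Omega> (\<lambda>x. c *\<^sub>R g x) z = 0"
      if "z \<in> L2 \<Omega>" "has_weak_gradient \<Omega> z K" for z K
    proof -
      have "c * (L2_inner \<Omega> G (\<lambda>x. bar (K x)) + L2_inner \<Omega> g z) = 0"
        using assms that by (auto simp: V0_data_def)
      then show ?thesis
        using L2.scale_left[OF D(2) L2_bar[OF has_weak_gradient_L2[OF that(2)]]] L2.scale_left[OF D(3) that(1)]
        by (simp only: distrib_left)
    qed
  qed (intro L2.scale_mem has_weak_gradient_scale has_weak_box_scale D)+
qed

text \<open>The approximating sequence is constant, and the trace condition is the weak gradient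
  identity of \<open>w\<close> tested with first derivatives of \<open>\<phi>\<close>. This yields
  both the zero element and a nontrivial element of \<open>V0_space\<close>.\<close>

lemma V0_data_test_function:
  assumes "\<phi> \<in> test_functions \<Omega>"
  shows "V0_data \<phi> (grad \<phi>) (wave \<phi>)"
proof -
  have zero: "L2_norm \<Omega> (\<lambda>x. 0 :: 'b::euclidean_space) = 0"
    by (simp add: L2.seminorm_def L2_inner_def)
  have "L2_inner \<Omega> (grad \<phi>) (\<lambda>x. bar (H x)) + L2_inner \<Omega> (wave \<phi>) w = 0"
    if "w \<in> L2 \<Omega>" "has_weak_gradient \<Omega> w H" for w H
  proof -
    have H: "H \<in> L2 \<Omega>" using that(2) by (rule has_weak_gradient_L2)
    have "L2_inner \<Omega> (grad \<phi>) (\<lambda>x. bar (H x)) = L2_inner \<Omega> (\<lambda>x. bar (H x)) (grad \<phi>)"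
      by (intro L2.sym grad_L2 L2_bar H assms)
    also have "\<dots> = L2_inner \<Omega> H (\<lambda>x. partial 1 \<phi> x *\<^sub>R axis 1 1 - partial 2 \<phi> x *\<^sub>R axis 2 1)"
      unfolding L2_inner_bar
      by (rule arg_cong[of _ _ "L2_inner \<Omega> H"]) (simp add: fun_eq_iff vec_eq_iff forall_2 grad_def axis_def)
    also have "\<dots> = L2_inner \<Omega> H (\<lambda>x. partial 1 \<phi> x *\<^sub>R axis 1 1) - L2_inner \<Omega> H (\<lambda>x. partial 2 \<phi> x *\<^sub>R axis 2 1)"
      using H assms by (intro L2.diff_right L2_axis partial_L2)
    also have "\<dots> = - L2_inner \<Omega> w (wave \<phi>)"
      using that assms by (simp add: has_weak_gradient_iff test_function_partial wave_L2_inner)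
    also have "L2_inner \<Omega> w (wave \<phi>) = L2_inner \<Omega> (wave \<phi>) w"
      by (intro L2.sym that test_function_L2 wave_test_function assms)
    finally show ?thesis by simp
  qed
  then show ?thesis
    by (intro V0_dataI[of \<phi> _ _ "\<lambda>k. \<phi>"] test_function_L2 has_weak_gradient_grad has_weak_box_wave assms)
      (simp_all add: zero)
qed

text \<open>For a fixed test function both sides of the weak identity are L2-continuous: the weak
  gradient is a closed operator.\<close>

lemma has_weak_gradient_limit:
  assumes s: "\<And>n. s n \<in> L2 \<Omega>" "\<And>n. has_weak_gradient \<Omega> (s n) (S n)"
    and mem: "v \<in> L2 \<Omega>" "G \<in> L2 \<Omega>"
    and lim: "(\<lambda>n. L2_norm \<Omega> (\<lambda>x. s n x - v x)) \<longlonglongrightarrow> 0" "(\<lambda>n. L2_norm \<Omega> (\<lambda>x. S n x - G x)) \<longlonglongrightarrow> 0"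
  shows "has_weak_gradient \<Omega> v G"
  unfolding has_weak_gradient_iff
proof (intro conjI ballI allI)
  fix \<phi> and i :: 2 assume \<phi>: "\<phi> \<in> test_functions \<Omega>"
  have "(\<lambda>n. L2_inner \<Omega> (s n) (partial i \<phi>)) \<longlonglongrightarrow> L2_inner \<Omega> v (partial i \<phi>)"
    by (intro L2.tendsto_left s mem lim partial_L2 \<phi>)
  moreover have "(\<lambda>n. - L2_inner \<Omega> (S n) (\<lambda>x. \<phi> x *\<^sub>R axis i 1)) \<longlonglongrightarrow> - L2_inner \<Omega> G (\<lambda>x. \<phi> x *\<^sub>R axis i 1)"
    by (intro tendsto_minus L2.tendsto_left has_weak_gradient_L2[OF s(2)] mem lim L2_axis test_function_L2 \<phi>)
  moreover have "L2_inner \<Omega> (s n) (partial i \<phi>) = - L2_inner \<Omega> (S n) (\<lambda>x. \<phi> x *\<^sub>R axis i 1)" for n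
    using s(2)[of n] \<phi> by (simp add: has_weak_gradient_iff)
  ultimately show "L2_inner \<Omega> v (partial i \<phi>) = - L2_inner \<Omega> G (\<lambda>x. \<phi> x *\<^sub>R axis i 1)"
    by (simp add: LIMSEQ_unique)
qed (rule mem)

lemma has_weak_box_limit:
  assumes s: "\<And>n. s n \<in> L2 \<Omega>" "\<And>n. has_weak_box \<Omega> (s n) (S n)"
    and mem: "v \<in> L2 \<Omega>" "g \<in> L2 \<Omega>"
    and lim: "(\<lambda>n. L2_norm \<Omega> (\<lambda>x. s n x - v x)) \<longlonglongrightarrow> 0" "(\<lambda>n. L2_norm \<Omega> (\<lambda>x. S n x - g x)) \<longlonglongrightarrow> 0"
  shows "has_weak_box \<Omega> v g"
  unfolding has_weak_box_iff
proof (intro conjI ballI)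
  fix \<phi> assume \<phi>: "\<phi> \<in> test_functions \<Omega>"
  have "(\<lambda>n. L2_inner \<Omega> (s n) (wave \<phi>)) \<longlonglongrightarrow> L2_inner \<Omega> v (wave \<phi>)"
    by (intro L2.tendsto_left s mem lim test_function_L2 wave_test_function \<phi>)
  moreover have "(\<lambda>n. L2_inner \<Omega> (S n) \<phi>) \<longlonglongrightarrow> L2_inner \<Omega> g \<phi>"
    by (intro L2.tendsto_left has_weak_box_L2[OF s(2)] mem lim test_function_L2 \<phi>)
  moreover have "L2_inner \<Omega> (s n) (wave \<phi>) = L2_inner \<Omega> (S n) \<phi>" for n
    using s(2)[of n] \<phi> by (simp add: has_weak_box_iff)
  ultimately show "L2_inner \<Omega> v (wave \<phi>) = L2_inner \<Omega> g \<phi>"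
    by (simp add: LIMSEQ_unique)
qed (rule mem)

lemma V0_data_limit:
  assumes s: "\<And>n. V0_data (s n) (S n) (t n)"
    and mem: "v \<in> L2 \<Omega>" "G \<in> L2 \<Omega>" "g \<in> L2 \<Omega>"
    and lim: "(\<lambda>n. L2_norm \<Omega> (\<lambda>x. s n x - v x)) \<longlonglongrightarrow> 0" "(\<lambda>n. L2_norm \<Omega> (\<lambda>x. S n x - G x)) \<longlonglongrightarrow> 0"
      "(\<lambda>n. L2_norm \<Omega> (\<lambda>x. t n x - g x)) \<longlonglongrightarrow> 0"
  shows "V0_data v G g"
proof -
  note D = V0_dataD[OF s]
  \<comment> \<open>Diagonal choice: one test function per index, close to the function and to its
    gradient at once, so that a single sequence approximates the limit in both.\<close>
  have "\<forall>n. \<exists>\<phi>. \<phi> \<in> test_functions \<Omega> \<and> L2_norm \<Omega> (\<lambda>x. s n x - \<phi> x) < inverse (Suc n) \<and>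
      L2_norm \<Omega> (\<lambda>x. S n x - grad \<phi> x) < inverse (Suc n)"
  proof
    fix n
    obtain \<phi> where \<phi>: "\<And>k::nat. \<phi> k \<in> test_functions \<Omega>"
      "(\<lambda>k. L2_norm \<Omega> (\<lambda>x. s n x - \<phi> k x)) \<longlonglongrightarrow> 0" "(\<lambda>k. L2_norm \<Omega> (\<lambda>x. S n x - grad (\<phi> k) x)) \<longlonglongrightarrow> 0"
      using V0_dataE[OF s[of n]] by blast
    have "\<forall>\<^sub>F k in sequentially. L2_norm \<Omega> (\<lambda>x. s n x - \<phi> k x) < inverse (Suc n) \<and>
        L2_norm \<Omega> (\<lambda>x. S n x - grad (\<phi> k) x) < inverse (Suc n)"
      by (intro eventually_conj order_tendstoD(2)[OF \<phi>(2)] order_tendstoD(2)[OF \<phi>(3)]) simp_all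
    then obtain k where "L2_norm \<Omega> (\<lambda>x. s n x - \<phi> k x) < inverse (Suc n) \<and>
        L2_norm \<Omega> (\<lambda>x. S n x - grad (\<phi> k) x) < inverse (Suc n)"
      using eventually_happens'[OF sequentially_bot] by force
    then show "\<exists>\<phi>. \<phi> \<in> test_functions \<Omega> \<and> L2_norm \<Omega> (\<lambda>x. s n x - \<phi> x) < inverse (Suc n) \<and>
        L2_norm \<Omega> (\<lambda>x. S n x - grad \<phi> x) < inverse (Suc n)"
      using \<phi>(1)[of k] by (intro exI[of _ "\<phi> k"] conjI) simp_all
  qed
  from choice[OF this] obtain \<phi> where "\<forall>n. \<phi> n \<in> test_functions \<Omega> \<and>
      L2_norm \<Omega> (\<lambda>x. s n x - \<phi> n x) < inverse (Suc n) \<and> L2_norm \<Omega> (\<lambda>x. S n x - grad (\<phi> n) x) < inverse (Suc n)"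
    by (rule exE)
  then have \<phi>: "\<phi> n \<in> test_functions \<Omega>" "L2_norm \<Omega> (\<lambda>x. s n x - \<phi> n x) < inverse (Suc n)"
      "L2_norm \<Omega> (\<lambda>x. S n x - grad (\<phi> n) x) < inverse (Suc n)" for n
    by simp_all
  have diagonal: "(\<lambda>n. L2_norm \<Omega> (\<lambda>x. a x - q n x)) \<longlonglongrightarrow> 0"
    if "\<And>n. L2_norm \<Omega> (\<lambda>x. p n x - q n x) < inverse (Suc n)" "(\<lambda>n. L2_norm \<Omega> (\<lambda>x. p n x - a x)) \<longlonglongrightarrow> 0"
      "a \<in> L2 \<Omega>" "\<And>n. p n \<in> L2 \<Omega>" "\<And>n. q n \<in> L2 \<Omega>"
    for a :: "real^2 \<Rightarrow> 'b::euclidean_space" and p q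
  proof (rule Lim_null_comparison)
    show "(\<lambda>n. L2_norm \<Omega> (\<lambda>x. p n x - a x) + inverse (Suc n)) \<longlonglongrightarrow> 0"
      using tendsto_add[OF that(2) LIMSEQ_inverse_real_of_nat] by simp
    have "L2_norm \<Omega> (\<lambda>x. a x - q n x) \<le> L2_norm \<Omega> (\<lambda>x. p n x - a x) + inverse (Suc n)" for n
      using L2.seminorm_triangle_diff[OF that(3) that(4)[of n] that(5)[of n]] that(1)[of n]
        L2.seminorm_minus_commute[OF that(3) that(4)[of n]] by linarith
    then show "\<forall>\<^sub>F n in sequentially. norm (L2_norm \<Omega> (\<lambda>x. a x - q n x)) \<le> L2_norm \<Omega> (\<lambda>x. p n x - a x) + inverse (Suc n)"
      using L2.seminorm_nonneg[OF L2.diff_mem[OF that(3,5)]] by (intro always_eventually allI) simp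
  qed
  have "(\<lambda>n. L2_norm \<Omega> (\<lambda>x. v x - \<phi> n x)) \<longlonglongrightarrow> 0"
    by (intro diagonal[OF \<phi>(2) lim(1)] mem D test_function_L2 \<phi>)
  moreover have "(\<lambda>n. L2_norm \<Omega> (\<lambda>x. G x - grad (\<phi> n) x)) \<longlonglongrightarrow> 0"
    by (intro diagonal[OF \<phi>(3) lim(2)] mem D grad_L2 \<phi>)
  moreover have "L2_inner \<Omega> G (\<lambda>x. bar (H x)) + L2_inner \<Omega> g w = 0"
    if w: "w \<in> L2 \<Omega>" "has_weak_gradient \<Omega> w H" for w H
  proof (rule LIMSEQ_unique)
    show "(\<lambda>n. L2_inner \<Omega> (S n) (\<lambda>x. bar (H x)) + L2_inner \<Omega> (t n) w)
        \<longlonglongrightarrow> L2_inner \<Omega> G (\<lambda>x. bar (H x)) + L2_inner \<Omega> g w"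
      by (intro tendsto_add L2.tendsto_left D mem lim w L2_bar has_weak_gradient_L2[OF w(2)])
    have "L2_inner \<Omega> (S n) (\<lambda>x. bar (H x)) + L2_inner \<Omega> (t n) w = 0" for n
      using s[of n] w by (simp add: V0_data_def)
    then show "(\<lambda>n. L2_inner \<Omega> (S n) (\<lambda>x. bar (H x)) + L2_inner \<Omega> (t n) w) \<longlonglongrightarrow> 0" by simp
  qed
  moreover have "has_weak_gradient \<Omega> v G"
    by (rule has_weak_gradient_limit[OF D(1,4) mem(1,2) lim(1,2)])
  moreover have "has_weak_box \<Omega> v g"
    by (rule has_weak_box_limit[OF D(1,5) mem(1,3) lim(1,3)])
  ultimately show ?thesis
    by (intro V0_dataI[of v G g \<phi>] mem(1) \<phi>(1))
qed

text \<open>The inequality for test functions is carried over along the approximating sequence,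
  since both sides are continuous under convergence of functions and gradients.\<close>

lemma Poincare:
  obtains C where "C \<ge> 0" "\<And>v G g. V0_data v G g \<Longrightarrow> L2_norm \<Omega> v \<le> C * L2_norm \<Omega> G"
proof -
  obtain R where R: "\<And>x. x \<in> \<Omega> \<Longrightarrow> norm x \<le> R" using bounded_\<Omega> by (auto simp: bounded_iff)
  define C where "C = 2 * \<bar>R\<bar>"
  have "C \<ge> 0" by (simp add: C_def)
  moreover have "L2_norm \<Omega> v \<le> C * L2_norm \<Omega> G" if data: "V0_data v G g" for v G g
  proof -
    note D = V0_dataD[OF data]
    obtain \<phi> where \<phi>: "\<And>k::nat. \<phi> k \<in> test_functions \<Omega>"
      "(\<lambda>k. L2_norm \<Omega> (\<lambda>x. v x - \<phi> k x)) \<longlonglongrightarrow> 0" "(\<lambda>k. L2_norm \<Omega> (\<lambda>x. G x - grad (\<phi> k) x)) \<longlonglongrightarrow> 0"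
      using V0_dataE[OF data] by blast
    have "(\<lambda>k. L2_norm \<Omega> (\<lambda>x. v x - \<phi> k x) + C * (L2_norm \<Omega> (\<lambda>x. G x - grad (\<phi> k) x) + L2_norm \<Omega> G))
        \<longlonglongrightarrow> 0 + C * (0 + L2_norm \<Omega> G)"
      by (intro tendsto_intros \<phi>)
    then have lim: "(\<lambda>k. L2_norm \<Omega> (\<lambda>x. v x - \<phi> k x) + C * (L2_norm \<Omega> (\<lambda>x. G x - grad (\<phi> k) x) + L2_norm \<Omega> G))
        \<longlonglongrightarrow> C * L2_norm \<Omega> G" by simp
    have "L2_norm \<Omega> v \<le> L2_norm \<Omega> (\<lambda>x. v x - \<phi> k x) + C * (L2_norm \<Omega> (\<lambda>x. G x - grad (\<phi> k) x) + L2_norm \<Omega> G)" for k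
    proof -
      have mem: "\<phi> k \<in> L2 \<Omega>" "grad (\<phi> k) \<in> L2 \<Omega>" using \<phi>(1)[of k] by (auto intro: test_function_L2 grad_L2)
      have "L2_norm \<Omega> v \<le> L2_norm \<Omega> (\<lambda>x. v x - \<phi> k x) + L2_norm \<Omega> (\<phi> k)"
        by (intro L2.seminorm_le_add_diff D mem)
      also have "L2_norm \<Omega> (\<phi> k) \<le> C * L2_norm \<Omega> (grad (\<phi> k))"
        unfolding C_def by (rule Poincare_test_function[OF \<phi>(1) R])
      also have "L2_norm \<Omega> (grad (\<phi> k)) \<le> L2_norm \<Omega> (\<lambda>x. G x - grad (\<phi> k) x) + L2_norm \<Omega> G"
        using L2.seminorm_le_add_diff[OF mem(2) D(2)] L2.seminorm_minus_commute[OF mem(2) D(2)] by simp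
      finally show ?thesis using \<open>C \<ge> 0\<close> by (simp add: mult_left_mono)
    qed
    then show ?thesis
      by (intro LIMSEQ_le_const[OF lim]) blast
  qed
  ultimately show ?thesis by (rule that)
qed

section \<open>The space of the variational problem\<close>

lemma V0_data_diff:
  assumes "V0_data v G g" "V0_data w H h"
  shows "V0_data (\<lambda>x. v x - w x) (\<lambda>x. G x - H x) (\<lambda>x. g x - h x)"
  using V0_data_add[OF assms(1) V0_data_scale[OF assms(2), of "-1"]] by simp

lemma V_inner_data:
  assumes "V0_data v G g" "V0_data w H h"
  shows "V_inner \<delta> \<Omega> v w = \<delta> * L2_inner \<Omega> g h + L2_inner \<Omega> G H"
  using V0_dataD[OF assms(1)] V0_dataD[OF assms(2)]
  by (simp add: V_inner_def weak_grad_inner_cong weak_box_inner_cong)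

lemma semi_inner_space_V0:
  assumes "\<delta> > 0"
  shows "semi_inner_space (V0_space \<Omega>) (V_inner \<delta> \<Omega>)"
proof
  show "(\<lambda>x. 0) \<in> V0_space \<Omega>"
    by (rule V0_spaceI[OF V0_data_test_function[OF test_function_zero]])
  fix u v w :: "real^2 \<Rightarrow> real" and c :: real
  assume "v \<in> V0_space \<Omega>" "w \<in> V0_space \<Omega>"
  then obtain G g H h where v: "V0_data v G g" and w: "V0_data w H h" using V0_space_data by blast
  note L2 = V0_dataD(2,3)[OF v] V0_dataD(2,3)[OF w]
  show "(\<lambda>x. v x + w x) \<in> V0_space \<Omega>" by (rule V0_spaceI[OF V0_data_add[OF v w]])
  show "(\<lambda>x. c *\<^sub>R v x) \<in> V0_space \<Omega>" by (rule V0_spaceI[OF V0_data_scale[OF v]])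
  show "V_inner \<delta> \<Omega> v w = V_inner \<delta> \<Omega> w v"
    using L2 by (simp add: V_inner_data[OF v w] V_inner_data[OF w v] L2.sym)
  show "V_inner \<delta> \<Omega> (\<lambda>x. c *\<^sub>R v x) w = c * V_inner \<delta> \<Omega> v w"
    unfolding V_inner_data[OF v w] V_inner_data[OF V0_data_scale[OF v] w]
      L2.scale_left[OF L2(1,3)] L2.scale_left[OF L2(2,4)]
    by (simp add: algebra_simps)
  show "0 \<le> V_inner \<delta> \<Omega> v v"
    using L2 assms by (simp add: V_inner_data[OF v v] L2.nonneg)
  assume "u \<in> V0_space \<Omega>"
  then obtain K k where u: "V0_data u K k" using V0_space_data by blast
  show "V_inner \<delta> \<Omega> (\<lambda>x. u x + v x) w = V_inner \<delta> \<Omega> u w + V_inner \<delta> \<Omega> v w"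
    using L2 V0_dataD(2,3)[OF u]
    by (simp add: V_inner_data[OF V0_data_add[OF u v] w] V_inner_data[OF u w] V_inner_data[OF v w]
        L2.add_left algebra_simps)
qed

lemma V_norm_data:
  assumes "V0_data v G g"
  shows "V_norm \<delta> \<Omega> v = sqrt (\<delta> * (L2_norm \<Omega> g)\<^sup>2 + (L2_norm \<Omega> G)\<^sup>2)"
  using V0_dataD[OF assms] by (simp add: V_norm_def V_inner_data[OF assms assms] L2.seminorm_power2)

lemma L2_norm_le_V_norm:
  assumes "\<delta> > 0"
  obtains K where "K > 0" "\<And>v G g. V0_data v G g \<Longrightarrow> L2_norm \<Omega> v \<le> K * V_norm \<delta> \<Omega> v"
    "\<And>v G g. V0_data v G g \<Longrightarrow> L2_norm \<Omega> G \<le> K * V_norm \<delta> \<Omega> v"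
    "\<And>v G g. V0_data v G g \<Longrightarrow> L2_norm \<Omega> g \<le> K * V_norm \<delta> \<Omega> v"
proof -
  obtain C where C: "C \<ge> 0" "\<And>v G g. V0_data v G g \<Longrightarrow> L2_norm \<Omega> v \<le> C * L2_norm \<Omega> G"
    using Poincare by blast
  \<comment> \<open>Dominates the constants for the gradient (1), the function (the Poincare
    constant) and the wave operator, which is weighted by \<delta> in the norm.\<close>
  define K where "K = 1 + C + 1 / sqrt \<delta>"
  have K: "K > 0" "1 \<le> K" "C \<le> K" "1 / sqrt \<delta> \<le> K"
    using C(1) assms by (auto simp: K_def add_pos_nonneg add_nonneg_pos)
  have G: "L2_norm \<Omega> G \<le> V_norm \<delta> \<Omega> v" and g: "L2_norm \<Omega> g \<le> (1 / sqrt \<delta>) * V_norm \<delta> \<Omega> v"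
    if "V0_data v G g" for v G g
  proof -
    show "L2_norm \<Omega> G \<le> V_norm \<delta> \<Omega> v"
      unfolding V_norm_data[OF that] using assms by (intro real_le_rsqrt) simp
    have "sqrt \<delta> * L2_norm \<Omega> g \<le> V_norm \<delta> \<Omega> v"
      unfolding V_norm_data[OF that] using assms by (intro real_le_rsqrt) (simp add: power_mult_distrib)
    then show "L2_norm \<Omega> g \<le> (1 / sqrt \<delta>) * V_norm \<delta> \<Omega> v"
      using assms by (simp add: field_simps)
  qed
  have V: "0 \<le> V_norm \<delta> \<Omega> v" if "V0_data v G g" for v G g
    using G[OF that] L2.seminorm_nonneg[OF V0_dataD(2)[OF that]] by simp
  show ?thesis
  proof
    fix v G g assume D: "V0_data v G g"
    show "L2_norm \<Omega> G \<le> K * V_norm \<delta> \<Omega> v"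
      using G[OF D] mult_right_mono[OF K(2) V[OF D]] by simp
    show "L2_norm \<Omega> g \<le> K * V_norm \<delta> \<Omega> v"
      using g[OF D] mult_right_mono[OF K(4) V[OF D]] by simp
    have "L2_norm \<Omega> v \<le> C * L2_norm \<Omega> G" by (rule C(2)[OF D])
    also have "\<dots> \<le> C * V_norm \<delta> \<Omega> v" by (intro mult_left_mono G[OF D] C(1))
    also have "\<dots> \<le> K * V_norm \<delta> \<Omega> v" by (intro mult_right_mono K(3) V[OF D])
    finally show "L2_norm \<Omega> v \<le> K * V_norm \<delta> \<Omega> v" .
  qed (rule K(1))
qed

lemma V0_complete:
  assumes "\<delta> > 0"
  shows "semi_inner_space.cauchy_complete (V0_space \<Omega>) (V_inner \<delta> \<Omega>)"
proof -
  interpret V0: semi_inner_space "V0_space \<Omega>" "V_inner \<delta> \<Omega>"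
    using assms by (rule semi_inner_space_V0)
  have seminorm_eq: "V0.seminorm v = V_norm \<delta> \<Omega> v" for v
    by (simp add: V0.seminorm_def V_norm_def)
  obtain K where K: "K > 0" "\<And>v G g. V0_data v G g \<Longrightarrow> L2_norm \<Omega> v \<le> K * V_norm \<delta> \<Omega> v"
    "\<And>v G g. V0_data v G g \<Longrightarrow> L2_norm \<Omega> G \<le> K * V_norm \<delta> \<Omega> v"
    "\<And>v G g. V0_data v G g \<Longrightarrow> L2_norm \<Omega> g \<le> K * V_norm \<delta> \<Omega> v"
    using L2_norm_le_V_norm[OF assms] by blast
  show ?thesis
    unfolding V0.cauchy_complete_def seminorm_eq
  proof (intro allI impI)
    fix s :: "nat \<Rightarrow> real^2 \<Rightarrow> real"
    assume s: "\<forall>n. s n \<in> V0_space \<Omega>"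
      and "\<forall>e>0. \<exists>N. \<forall>m\<ge>N. \<forall>n\<ge>N. V_norm \<delta> \<Omega> (\<lambda>x. s m x - s n x) < e"
    then have cau: "\<exists>N. \<forall>m\<ge>N. \<forall>n\<ge>N. V_norm \<delta> \<Omega> (\<lambda>x. s m x - s n x) < e" if "e > 0" for e
      using that by simp
    define G where "G n = weak_grad \<Omega> (s n)" for n
    define g where "g n = weak_box \<Omega> (s n)" for n
    have D: "V0_data (s n) (G n) (g n)" for n
      unfolding G_def g_def using s V0_space_data by simp
    have DD: "V0_data (\<lambda>x. s m x - s n x) (\<lambda>x. G m x - G n x) (\<lambda>x. g m x - g n x)" for m n
      by (rule V0_data_diff[OF D D])
    obtain v where v: "v \<in> L2 \<Omega>" "(\<lambda>n. L2_norm \<Omega> (\<lambda>x. s n x - v x)) \<longlonglongrightarrow> 0"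
      by (rule L2_Cauchy_limit[OF V0_dataD(1)[OF D] K(2)[OF DD] cau K(1)])
    obtain G' where G': "G' \<in> L2 \<Omega>" "(\<lambda>n. L2_norm \<Omega> (\<lambda>x. G n x - G' x)) \<longlonglongrightarrow> 0"
      by (rule L2_Cauchy_limit[OF V0_dataD(2)[OF D] K(3)[OF DD] cau K(1)])
    obtain g' where g': "g' \<in> L2 \<Omega>" "(\<lambda>n. L2_norm \<Omega> (\<lambda>x. g n x - g' x)) \<longlonglongrightarrow> 0"
      by (rule L2_Cauchy_limit[OF V0_dataD(3)[OF D] K(4)[OF DD] cau K(1)])
    \<comment> \<open>The three limits were obtained independently; closedness identifies the last
      two as the derivatives of the first.\<close>
    have D': "V0_data v G' g'"
      by (rule V0_data_limit[OF D v(1) G'(1) g'(1) v(2) G'(2) g'(2)])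
    have "(\<lambda>n. sqrt (\<delta> * (L2_norm \<Omega> (\<lambda>x. g n x - g' x))\<^sup>2 + (L2_norm \<Omega> (\<lambda>x. G n x - G' x))\<^sup>2))
        \<longlonglongrightarrow> sqrt (\<delta> * 0\<^sup>2 + 0\<^sup>2)"
      by (intro tendsto_intros g' G')
    then have "(\<lambda>n. V_norm \<delta> \<Omega> (\<lambda>x. s n x - v x)) \<longlonglongrightarrow> 0"
      by (simp add: V_norm_data[OF V0_data_diff[OF D D']])
    then show "\<exists>u\<in>V0_space \<Omega>. (\<lambda>n. V_norm \<delta> \<Omega> (\<lambda>x. s n x - u x)) \<longlonglongrightarrow> 0"
      using V0_spaceI[OF D'] by (intro bexI[of _ v])
  qed
qed

text \<open>The Poincare inequality gives one direction. For the other, a null function admits zero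
  as weak gradient and weak wave operator. Hence the functions left out of the dual norm are exactly
  those with vanishing denominator.\<close>

lemma V_norm_eq_0_iff:
  assumes "\<delta> > 0" "v \<in> V0_space \<Omega>"
  shows "V_norm \<delta> \<Omega> v = 0 \<longleftrightarrow> (AE x in lebesgue_on \<Omega>. v x = 0)"
proof
  note D = V0_space_data[OF assms(2)]
  obtain K where K: "\<And>v G g. V0_data v G g \<Longrightarrow> L2_norm \<Omega> v \<le> K * V_norm \<delta> \<Omega> v"
    using L2_norm_le_V_norm[OF assms(1)] by metis
  show "AE x in lebesgue_on \<Omega>. v x = 0" if "V_norm \<delta> \<Omega> v = 0"
    using K[OF D] that L2.seminorm_nonneg[OF V0_dataD(1)[OF D]] L2_norm_eq_0_iff[OF V0_dataD(1)[OF D]]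
    by simp
  assume AE: "AE x in lebesgue_on \<Omega>. v x = 0"
  have v0: "L2_inner \<Omega> v \<phi> = 0" if "\<phi> \<in> L2 \<Omega>" for \<phi>
  proof -
    have "L2_inner \<Omega> v \<phi> = L2_inner \<Omega> (\<lambda>x. 0) \<phi>"
      using AE that V0_dataD(1)[OF D] L2.zero_mem by (intro L2_inner_cong_AE) auto
    then show ?thesis by (simp add: L2_inner_def)
  qed
  have "has_weak_gradient \<Omega> v (\<lambda>x. 0)"
    unfolding has_weak_gradient_iff using L2.zero_mem
    by (auto simp: v0 partial_L2) (simp add: L2_inner_def)
  moreover have "has_weak_box \<Omega> v (\<lambda>x. 0)"
    unfolding has_weak_box_iff using L2.zero_mem
    by (auto simp: v0 test_function_L2 wave_test_function) (simp add: L2_inner_def)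
  ultimately have "V_inner \<delta> \<Omega> v v = 0"
    by (simp add: V_inner_def weak_grad_inner_cong weak_box_inner_cong) (simp add: L2_inner_def)
  then show "V_norm \<delta> \<Omega> v = 0" by (simp add: V_norm_def)
qed

text \<open>Keeps the supremum in \<open>V_dual_norm\<close> from ranging over the empty set. The
  witness is a bump on a box inside \<Omega>, nonzero on a set of positive measure.\<close>

lemma V0_space_nontrivial:
  assumes "\<Omega> \<noteq> {}"
  obtains v where "v \<in> V0_space \<Omega>" "\<not> (AE x in lebesgue_on \<Omega>. v x = 0)"
proof -
  obtain p where "p \<in> \<Omega>" using assms by blast
  from open_contains_cbox[OF open_\<Omega> this] obtain a b where ab: "p \<in> box a b" "cbox a b \<subseteq> \<Omega>"
    by metis
  have bump: "bump a b 1 \<in> test_functions \<Omega>" using ab by (intro bump_test_function) auto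
  have "\<not> (AE x in lebesgue_on \<Omega>. bump a b 1 x = 0)"
  proof
    assume "AE x in lebesgue_on \<Omega>. bump a b 1 x = 0"
    then have "AE x in lebesgue. x \<in> \<Omega> \<longrightarrow> bump a b 1 x = 0"
      using sets_\<Omega> by (simp add: AE_restrict_space_iff)
    then have "AE x in lebesgue. x \<notin> box a b"
      by eventually_elim (use ab box_subset_cbox[of a b] in \<open>auto simp: bump_eq_0_iff\<close>)
    then have "emeasure lebesgue (box a b) = 0"
      using AE_iff_measurable[of "box a b" lebesgue "\<lambda>x. x \<notin> box a b"] by simp
    then have "negligible (box a b)"
      by (simp add: negligible_iff_null_sets null_sets_def)
    then show False using ab(1) by (simp add: negligible_interval)
  qed
  then show ?thesis using that V0_spaceI[OF V0_data_test_function[OF bump]] by blast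
qed

end

theorem theorem2p1:
  fixes \<Omega> :: "(real^2) set" and \<delta> :: real and f :: "(real^2 \<Rightarrow> real) \<Rightarrow> real"
  assumes "is_domain \<Omega>" and "bounded \<Omega>" and "piecewise_smooth_boundary \<Omega>"
    and "0 < \<delta>" and "\<delta> < 1"
    and "f \<in> V_dual \<delta> \<Omega>"
  shows "\<exists>u\<in>V0_space \<Omega>.
           (\<forall>v\<in>V0_space \<Omega>. A_form \<delta> \<Omega> u v = f v) \<and>
           (\<forall>w\<in>V0_space \<Omega>. (\<forall>v\<in>V0_space \<Omega>. A_form \<delta> \<Omega> w v = f v) \<longrightarrow>
              (AE x in lebesgue_on \<Omega>. w x = u x)) \<and>
           V_norm \<delta> \<Omega> u \<le> V_dual_norm \<delta> \<Omega> f"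
proof -
  interpret bounded_open \<Omega>
    using assms(1,2) by unfold_locales (auto simp: is_domain_def)
  interpret V0: semi_inner_space "V0_space \<Omega>" "V_inner \<delta> \<Omega>"
    using \<open>0 < \<delta>\<close> by (rule semi_inner_space_V0)
  have seminorm_eq: "V0.seminorm v = V_norm \<delta> \<Omega> v" for v
    by (simp add: V0.seminorm_def V_norm_def)
  obtain C where C: "\<bar>f v\<bar> \<le> C * V_norm \<delta> \<Omega> v" if "v \<in> V0_space \<Omega>" for v
    using assms(6) unfolding V_dual_def by blast
  have "\<exists>u\<in>V0_space \<Omega>. \<forall>v\<in>V0_space \<Omega>. V_inner \<delta> \<Omega> u v = f v"
  proof (rule V0.Riesz_representation)
    show "V0.cauchy_complete" using \<open>0 < \<delta>\<close> by (rule V0_complete)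
    show "\<bar>f v\<bar> \<le> C * V0.seminorm v" if "v \<in> V0_space \<Omega>" for v
      using C[OF that] by (simp add: seminorm_eq)
  qed (use assms(6) in \<open>auto simp: V_dual_def\<close>)
  then obtain u where u: "u \<in> V0_space \<Omega>" "\<And>v. v \<in> V0_space \<Omega> \<Longrightarrow> V_inner \<delta> \<Omega> u v = f v"
    by blast
  have unique: "AE x in lebesgue_on \<Omega>. w x = u x"
    if w: "w \<in> V0_space \<Omega>" "\<forall>v\<in>V0_space \<Omega>. A_form \<delta> \<Omega> w v = f v" for w
  proof -
    let ?d = "\<lambda>x. w x - u x"
    have d: "?d \<in> V0_space \<Omega>" by (rule V0.diff_mem[OF w(1) u(1)])
    \<comment> \<open>The difference of two solutions is orthogonal to \<open>V0_space\<close>,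
      hence to itself.\<close>
    have "V_inner \<delta> \<Omega> ?d ?d = 0"
      using w(2) u(2)[OF d] d by (simp add: V0.diff_left[OF w(1) u(1) d] A_form_def)
    then have "AE x in lebesgue_on \<Omega>. ?d x = 0"
      using V_norm_eq_0_iff[OF \<open>0 < \<delta>\<close> d] by (simp add: V_norm_def)
    then show ?thesis by simp
  qed
  let ?S = "{v \<in> V0_space \<Omega>. \<not> (AE x in lebesgue_on \<Omega>. v x = 0)}"
  let ?q = "\<lambda>v. \<bar>f v\<bar> / V_norm \<delta> \<Omega> v"
  have V_norm_nonneg: "0 \<le> V_norm \<delta> \<Omega> v" if "v \<in> V0_space \<Omega>" for v
    using V0.seminorm_nonneg[OF that] by (simp add: seminorm_eq)
  \<comment> \<open>A real supremum dominates its members only when bounded above; the continuity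
    constant \<open>C\<close> of \<open>f\<close> supplies the bound.\<close>
  have bdd: "bdd_above (?q ` ?S)"
  proof (rule bdd_aboveI2)
    fix v assume v: "v \<in> ?S"
    then have "V_norm \<delta> \<Omega> v > 0"
      using V_norm_nonneg[of v] V_norm_eq_0_iff[OF \<open>0 < \<delta>\<close>, of v] by (auto simp: less_le)
    then show "?q v \<le> C" using C[of v] v by (simp add: divide_le_eq)
  qed
  have dual_norm_ge: "?q v \<le> V_dual_norm \<delta> \<Omega> f" if "v \<in> ?S" for v
    unfolding V_dual_norm_def using that bdd by (rule cSUP_upper)
  have "V_norm \<delta> \<Omega> u \<le> V_dual_norm \<delta> \<Omega> f"
  proof (cases "V_norm \<delta> \<Omega> u = 0")
    \<comment> \<open>Here \<open>u\<close> is a null function and does not compete in the supremum;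
      any nontrivial element shows that the dual norm is at least 0.\<close>
    case True
    have "\<Omega> \<noteq> {}" using assms(1) by (simp add: is_domain_def)
    then obtain v where v: "v \<in> ?S" using V0_space_nontrivial by blast
    then have "0 \<le> ?q v" using V_norm_nonneg by simp
    then show ?thesis using True dual_norm_ge[OF v] by linarith
  next
    case False
    then have uS: "u \<in> ?S" using u(1) V_norm_eq_0_iff[OF \<open>0 < \<delta>\<close> u(1)] by simp
    \<comment> \<open>Testing the equation with \<open>u\<close> makes its own quotient equal to
      \<open>V_norm \<delta> \<Omega> u\<close>.\<close>
    have "f u = (V_norm \<delta> \<Omega> u)\<^sup>2"
      using V0.seminorm_power2[OF u(1)] u(2)[OF u(1)] by (simp add: seminorm_eq)
    then have "?q u = V_norm \<delta> \<Omega> u"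
      using False by (simp add: power2_eq_square)
    then show ?thesis using dual_norm_ge[OF uS] by simp
  qed
  then show ?thesis using u unique by (intro bexI[of _ u]) (auto simp: A_form_def)
qed

end
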